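(* Consider the two-player entry game with bivariate standard normal errors described in the context, with $\Theta\subset(-\infty,0)^2$. For every $\theta\in\Theta$, $L_\theta\Gamma_\theta=\mathbb E_H[Q_\theta]$, and this set is closed in total variation. Hence $\overline{\mathcal M}_\theta=\mathbb E_H[Q_\theta]$, and the identified set $\{\theta\in\Theta:\mu^*\in\overline{\mathcal M}_\theta\}$ equals the sharp identification region $\{\theta\in\Theta:\mu^*\in\mathbb E_H[Q_\theta]\}$ of Beresteanu, Molchanov and Molinari.
   Context: Game. Firms $j=1,2$ choose $y_j\in\{0,1\}$; at error realization $v=(v_1,v_2)\in\mathbb R^2$ firm $j$ earns $y_j(\delta_jy_{-j}+v_j)$, with $\theta=(\delta_1,\delta_2)$, $\delta_1,\delta_2<0$. $V=(V_1,V_2)$ has distribution $H=N(0,1)\otimes N(0,1)$. $\mathcal Y=\{(0,0),(1,0),(0,1),(1,1)\}$ (in this order), $\mathcal P(\mathcal Y)$ is identified with probability vectors in $\mathbb R^4$, $e_y$ is the point mass at $y$, and $\mu^*\in\mathcal P(\mathcal Y)$ is the true distribution of the action profile. $Q_\theta(v)\subseteq\mathcal P(\mathcal Y)$ is the set of outcome distributions of all Nash equilibria in mixed strategies at $v$: all product distributions of independent entries with probabilities $(\sigma_1,\sigma_2)\in[0,1]^2$ such that, for each $j$, $\sigma_j$ maximizes $s\mapsto s(\delta_j\sigma_{-j}+v_j)$ over $s\in[0,1]$. Aumann expectation: $\mathbb E_H[Q_\theta]=\{\int q(v)\,H(dv): q:\mathbb R^2\to\mathcal P(\mathcal Y)\text{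 measurable},\ q(v)\in Q_\theta(v)\ \forall v\}$. Completed model. $B_{j,\theta}=[0,-\delta_j)$; multiplicity cell $B_{1,\theta}\times B_{2,\theta}$; $\mathcal N_\theta=\{v:v_j\in\{0,-\delta_j\}\text{ for some }j\}$. For $v\notin\mathcal N_\theta$ outside the cell, the equilibrium is unique and pure, with profile $y_\theta(v)$. For $v\notin\mathcal N_\theta$ in the cell, there are three equilibria: the pure profiles $(1,0)$ and $(0,1)$, and the mixed one in which firm $j$ enters with probability $\sigma_j=v_{-j}/(-\delta_{-j})$, inducing $q^{\mathrm{mix}}_\theta(v)=((1-\sigma_1)(1-\sigma_2),\sigma_1(1-\sigma_2),(1-\sigma_1)\sigma_2,\sigma_1\sigma_2)$. The selector is $S\in\mathcal S=\{1,2,3\}$. The kernel from $\mathbb R^2\times\mathcal S$ to $\mathcal Y$ is: for $v\notin\mathcal N_\theta$, $K_\theta(\cdot\mid v,s)=e_{y_\theta(v)}$ outside the cell; in the cell $K_\theta(\cdot\mid v,1)=e_{(1,0)}$, $K_\theta(\cdot\mid v,2)=e_{(0,1)}$, $K_\theta(\cdot\mid v,3)=q_\theta^{\mathrm{mix}}(v)$; for $v\in\mathcal N_\theta$, $K_\theta(\cdot\mid v,s)=e_y$ for all $s$, where $y$ is the first profile in the order of $\mathcal Y$ that is a pure-strategy equilibrium at $v$. $\Gamma_\theta$ is the set of probability measures $\gamma$ on $\mathbb R^2\times\mathcal S$ with $\mathbb E_\gamma[1\{V\le c\}-H((-\infty,c])]=0$ for all $c\in\mathbb R^2$ (componentwise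 inequality), i.e. with $V$-marginal $H$. $(L_\theta\gamma)(\{y\})=\int K_\theta(\{y\}\mid v,s)\,d\gamma(v,s)$, and $\overline{\mathcal M}_\theta$ is the total variation closure of $L_\theta\Gamma_\theta=\{L_\theta\gamma:\gamma\in\Gamma_\theta\}$ in $\mathcal P(\mathcal Y)$. *)

theory Defs
  imports "HOL-Probability.Probability"
begin

type_synonym profile = "bool \<times> bool"

text \<open>Vectors of length four, indexed by action profiles; \<open>True\<close> stands for entry (action 1).\<close>

type_synonym dist4 = "real ^ profile"

definition profiles :: "profile list" where
  "profiles = [(False, False), (True, False), (False, True), (True, True)]"

definition prob_vecs :: "dist4 set" where
  "prob_vecs = {p. (\<forall>y. 0 \<le> p $ y) \<and> (\<Sum>y\<in>UNIV. p $ y) = 1}"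

definition point_mass :: "profile \<Rightarrow> dist4" where
  "point_mass y = (\<chi> z. of_bool (z = y))"

definition errH :: "(real \<times> real) measure" where
  "errH = density lborel std_normal_density \<Otimes>\<^sub>M density lborel std_normal_density"

text \<open>Payoff of a firm with interaction parameter \<open>d\<close> and error \<open>w\<close> that enters with
  probability \<open>s\<close> while its rival enters with probability \<open>t\<close>.\<close>

definition payoff :: "real \<Rightarrow> real \<Rightarrow> real \<Rightarrow> real \<Rightarrow> real" where
  "payoff d w s t = s * (d * t + w)"

definition mixed_equilibria :: "real \<times> real \<Rightarrow> real \<times> real \<Rightarrow> (real \<times> real) set" where
  "mixed_equilibria \<theta> v = {(s1, s2). s1 \<in> {0..1} \<and> s2 \<in> {0..1} \<and>
     (\<forall>s\<in>{0..1}. payoff (fst \<theta>) (fst v) s s2 \<le> payoff (fst \<theta>) (fst v) s1 s2) \<and>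
     (\<forall>s\<in>{0..1}. payoff (snd \<theta>) (snd v) s s1 \<le> payoff (snd \<theta>) (snd v) s2 s1)}"

definition pure_equilibrium :: "real \<times> real \<Rightarrow> real \<times> real \<Rightarrow> profile \<Rightarrow> bool" where
  "pure_equilibrium \<theta> v = (\<lambda>(y1, y2).
     (\<forall>y. payoff (fst \<theta>) (fst v) (of_bool y) (of_bool y2)
            \<le> payoff (fst \<theta>) (fst v) (of_bool y1) (of_bool y2)) \<and>
     (\<forall>y. payoff (snd \<theta>) (snd v) (of_bool y) (of_bool y1)
            \<le> payoff (snd \<theta>) (snd v) (of_bool y2) (of_bool y1)))"

definition product_dist :: "real \<times> real \<Rightarrow> dist4" where
  "product_dist = (\<lambda>(s1, s2). \<chi> y.
     (if fst y then s1 else 1 - s1) * (if snd y then s2 else 1 - s2))"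

definition Q :: "real \<times> real \<Rightarrow> real \<times> real \<Rightarrow> dist4 set" where
  "Q \<theta> v = product_dist ` mixed_equilibria \<theta> v"

definition aumann_expectation :: "real \<times> real \<Rightarrow> dist4 set" where
  "aumann_expectation \<theta> =
     {(LINT v|errH. q v) | q. q \<in> borel_measurable borel \<and> (\<forall>v. q v \<in> Q \<theta> v)}"

definition mult_cell :: "real \<times> real \<Rightarrow> (real \<times> real) set" where
  "mult_cell \<theta> = {0..<- fst \<theta>} \<times> {0..<- snd \<theta>}"

definition null_set :: "real \<times> real \<Rightarrow> (real \<times> real) set" where
  "null_set \<theta> = {v. fst v \<in> {0, - fst \<theta>} \<or> snd v \<in> {0, - snd \<theta>}}"

text \<open>The profile of the unique equilibrium; meaningful off \<open>null_set \<theta> \<union> mult_cell \<theta>\<close>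
  by \<open>unique_profile_exists\<close> below.\<close>

definition unique_profile :: "real \<times> real \<Rightarrow> real \<times> real \<Rightarrow> profile" where
  "unique_profile \<theta> v =
     (THE y. mixed_equilibria \<theta> v = {(of_bool (fst y), of_bool (snd y))})"

definition mix_probs :: "real \<times> real \<Rightarrow> real \<times> real \<Rightarrow> real \<times> real" where
  "mix_probs \<theta> v = (snd v / (- snd \<theta>), fst v / (- fst \<theta>))"

definition selectors :: "nat set" where
  "selectors = {1, 2, 3}"

definition kernel :: "real \<times> real \<Rightarrow> real \<times> real \<Rightarrow> nat \<Rightarrow> dist4" where
  "kernel \<theta> v s =
     (if v \<in> null_set \<theta> then point_mass (the (find (pure_equilibrium \<theta> v) profiles))
      else if v \<notin> mult_cell \<theta> then point_mass (unique_profile \<theta> v)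
      else if s = 1 then point_mass (True, False)
      else if s = 2 then point_mass (False, True)
      else product_dist (mix_probs \<theta> v))"

text \<open>The admissible joint laws of error and selector. The moment conditions do not involve
  the parameter. The order on pairs is componentwise, so \<open>{..c}\<close> is a lower-left quadrant.\<close>

definition Gam :: "((real \<times> real) \<times> nat) measure set" where
  "Gam = {\<gamma>. prob_space \<gamma> \<and> sets \<gamma> = sets (borel \<Otimes>\<^sub>M count_space selectors) \<and>
     (\<forall>c. (LINT x|\<gamma>. indicator {..c} (fst x) - measure errH {..c}) = (0 :: real))}"

definition L :: "real \<times> real \<Rightarrow> ((real \<times> real) \<times> nat) measure \<Rightarrow> dist4" where
  "L \<theta> \<gamma> = (\<chi> y. LINT x|\<gamma>. kernel \<theta> (fst x) (snd x) $ y)"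

definition tv_dist :: "dist4 \<Rightarrow> dist4 \<Rightarrow> real" where
  "tv_dist p q = (SUP A. \<bar>(\<Sum>y\<in>A. p $ y) - (\<Sum>y\<in>A. q $ y)\<bar>)"

definition tv_topology :: "dist4 topology" where
  "tv_topology = Metric_space.mtopology prob_vecs tv_dist"

definition Mbar :: "real \<times> real \<Rightarrow> dist4 set" where
  "Mbar \<theta> = tv_topology closure_of (L \<theta> ` Gam)"

lemma tv_dist_upper: "\<bar>(\<Sum>y\<in>A. p $ y) - (\<Sum>y\<in>A. q $ y)\<bar> \<le> tv_dist p q"
  unfolding tv_dist_def by (rule cSUP_upper) (auto intro: bdd_above_finite)

lemma Metric_space_tv: "Metric_space prob_vecs tv_dist"
proof
  show "0 \<le> tv_dist p q" for p q
    using tv_dist_upper[of p "{}" q] by simp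
  show "tv_dist p q = tv_dist q p" for p q
    unfolding tv_dist_def by (simp add: abs_minus_commute)
  show "tv_dist p q = 0 \<longleftrightarrow> p = q" for p q
  proof
    assume "tv_dist p q = 0"
    then have "p $ y = q $ y" for y
      using tv_dist_upper[of p "{y}" q] by simp
    then show "p = q" by (simp add: vec_eq_iff)
  qed (simp add: tv_dist_def)
  show "tv_dist p r \<le> tv_dist p q + tv_dist q r" for p q r
    unfolding tv_dist_def[of p r]
  proof (rule cSUP_least)
    fix A :: "profile set"
    show "\<bar>(\<Sum>y\<in>A. p $ y) - (\<Sum>y\<in>A. r $ y)\<bar> \<le> tv_dist p q + tv_dist q r"
      using tv_dist_upper[of p A q] tv_dist_upper[of q A r] by linarith
  qed simp
qed

lemma best_reply_iff:
  assumes "s \<in> {0..1}"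
  shows "(\<forall>s'\<in>{0..1}. payoff d w s' t \<le> payoff d w s t) \<longleftrightarrow>
    (d * t + w > 0 \<longrightarrow> s = 1) \<and> (d * t + w < 0 \<longrightarrow> s = 0)"
proof
  assume "\<forall>s'\<in>{0..1}. payoff d w s' t \<le> payoff d w s t"
  then have "payoff d w 0 t \<le> payoff d w s t" "payoff d w 1 t \<le> payoff d w s t" by auto
  then show "(d * t + w > 0 \<longrightarrow> s = 1) \<and> (d * t + w < 0 \<longrightarrow> s = 0)"
    using assms by (auto simp: payoff_def zero_le_mult_iff mult_le_cancel_right1)
next
  assume "(d * t + w > 0 \<longrightarrow> s = 1) \<and> (d * t + w < 0 \<longrightarrow> s = 0)"
  then show "\<forall>s'\<in>{0..1}. payoff d w s' t \<le> payoff d w s t"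
    using assms by (cases "d * t + w" "0 :: real" rule: linorder_cases)
      (auto simp: payoff_def mult_le_0_iff mult_le_cancel_right2)
qed

lemma mixed_equilibria_iff:
  "(s1, s2) \<in> mixed_equilibria \<theta> v \<longleftrightarrow> s1 \<in> {0..1} \<and> s2 \<in> {0..1} \<and>
    (fst \<theta> * s2 + fst v > 0 \<longrightarrow> s1 = 1) \<and> (fst \<theta> * s2 + fst v < 0 \<longrightarrow> s1 = 0) \<and>
    (snd \<theta> * s1 + snd v > 0 \<longrightarrow> s2 = 1) \<and> (snd \<theta> * s1 + snd v < 0 \<longrightarrow> s2 = 0)"
proof (cases "s1 \<in> {0..1} \<and> s2 \<in> {0..1}")
  case True
  then show ?thesis
    unfolding mixed_equilibria_def mem_Collect_eq prod.case
    by (simp only: best_reply_iff[of s1] best_reply_iff[of s2] simp_thms conj_assoc)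
next
  case False
  then show ?thesis unfolding mixed_equilibria_def by blast
qed

lemma interaction_bounds:
  fixes d s :: real
  assumes "d < 0" "s \<in> {0..1}"
  shows "d \<le> d * s" "d * s \<le> 0"
  using assms mult_left_mono_neg[of s 1 d] mult_left_mono_neg[of 0 s d] by simp_all

lemma unique_profile_exists:
  assumes "fst \<theta> < 0" "snd \<theta> < 0" "v \<notin> null_set \<theta>" "v \<notin> mult_cell \<theta>"
  shows "\<exists>!y. mixed_equilibria \<theta> v = {(of_bool (fst y), of_bool (snd y))}"
proof -
  obtain a b where \<theta>: "\<theta> = (a, b)" by (cases \<theta>)
  obtain x y where v: "v = (x, y)" by (cases v)
  have ab: "a < 0" "b < 0" using assms \<theta> by auto
  have nz: "x \<noteq> 0" "x \<noteq> - a" "y \<noteq> 0" "y \<noteq> - b"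
    using assms(3) by (auto simp: null_set_def \<theta> v)
  have out: "x < 0 \<or> x > - a \<or> y < 0 \<or> y > - b"
    using assms(4) nz by (auto simp: mult_cell_def \<theta> v)
  define E where "E = mixed_equilibria \<theta> v"
  have E: "(s, t) \<in> E \<longleftrightarrow> s \<in> {0..1} \<and> t \<in> {0..1} \<and>
    (a * t + x > 0 \<longrightarrow> s = 1) \<and> (a * t + x < 0 \<longrightarrow> s = 0) \<and>
    (b * s + y > 0 \<longrightarrow> t = 1) \<and> (b * s + y < 0 \<longrightarrow> t = 0)" for s t
    unfolding E_def mixed_equilibria_iff \<theta> v by simp
  have bd: "a \<le> a * t \<and> a * t \<le> 0" "b \<le> b * t \<and> b * t \<le> 0" if "t \<in> {0..1}" for t
    using interaction_bounds[OF ab(1) that] interaction_bounds[OF ab(2) that] by auto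
  have ex: "\<exists>p q. E = {(of_bool p, of_bool q)}"
    if *: "\<And>s t. (s, t) \<in> E \<Longrightarrow> s = of_bool p \<and> t = of_bool q"
      "(of_bool p, of_bool q) \<in> E" for p q
  proof -
    have "z = (of_bool p, of_bool q)" if "z \<in> E" for z
      using *(1)[of "fst z" "snd z"] that by (simp add: prod_eq_iff)
    then have "E = {(of_bool p, of_bool q)}" using *(2) by blast
    then show ?thesis by blast
  qed
  have "\<exists>p q. E = {(of_bool p, of_bool q)}"
  proof -
    consider "x < 0" | "x > - a" | "y < 0" | "y > - b" using out by blast
    then show ?thesis
    proof cases
      case 1
      show ?thesis
      proof (rule ex[of False "y > 0"])
        fix s t
        assume st: "(s, t) \<in> E"
        then have "t \<in> {0..1}" unfolding E by blast
        then have "a * t + x < 0" using bd(1) 1 by smt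
        then have *: "s = 0" using st unfolding E by blast
        have "y > 0 \<or> y < 0" using nz by linarith
        then have "t = of_bool (y > 0)"
        proof
          assume c: "y > 0"
          then have "b * s + y > 0" using * by simp
          then have "t = 1" using st unfolding E by blast
          with c show ?thesis by simp
        next
          assume c: "y < 0"
          then have "b * s + y < 0" using * by simp
          then have "t = 0" using st unfolding E by blast
          with c show ?thesis by simp
        qed
        with * show "s = of_bool False \<and> t = of_bool (y > 0)" by simp
      next
        show "(of_bool False, of_bool (y > 0)) \<in> E"
          unfolding E using 1 nz ab by (cases "y > 0") simp_all
      qed
    next
      case 2
      show ?thesis
      proof (rule ex[of True "y > - b"])
        fix s t
        assume st: "(s, t) \<in> E"
        then have "t \<in> {0..1}" unfolding E by blast
        then have "a * t + x > 0" using bd(1) 2 by smt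
        then have *: "s = 1" using st unfolding E by blast
        have "y > - b \<or> y < - b" using nz by linarith
        then have "t = of_bool (y > - b)"
        proof
          assume c: "y > - b"
          then have "b * s + y > 0" using * by simp
          then have "t = 1" using st unfolding E by blast
          with c show ?thesis by simp
        next
          assume c: "y < - b"
          then have "b * s + y < 0" using * by simp
          then have "t = 0" using st unfolding E by blast
          with c show ?thesis by simp
        qed
        with * show "s = of_bool True \<and> t = of_bool (y > - b)" by simp
      next
        show "(of_bool True, of_bool (y > - b)) \<in> E"
          unfolding E using 2 nz ab by (cases "y > - b") simp_all
      qed
    next
      case 3
      show ?thesis
      proof (rule ex[of "x > 0" False])
        fix s t
        assume st: "(s, t) \<in> E"
        then have "s \<in> {0..1}" unfolding E by blast
        then have "b * s + y < 0" using bd(2) 3 by smt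
        then have *: "t = 0" using st unfolding E by blast
        have "x > 0 \<or> x < 0" using nz by linarith
        then have "s = of_bool (x > 0)"
        proof
          assume c: "x > 0"
          then have "a * t + x > 0" using * by simp
          then have "s = 1" using st unfolding E by blast
          with c show ?thesis by simp
        next
          assume c: "x < 0"
          then have "a * t + x < 0" using * by simp
          then have "s = 0" using st unfolding E by blast
          with c show ?thesis by simp
        qed
        with * show "s = of_bool (x > 0) \<and> t = of_bool False" by simp
      next
        show "(of_bool (x > 0), of_bool False) \<in> E"
          unfolding E using 3 nz ab by (cases "x > 0") simp_all
      qed
    next
      case 4
      show ?thesis
      proof (rule ex[of "x > - a" True])
        fix s t
        assume st: "(s, t) \<in> E"
        then have "s \<in> {0..1}" unfolding E by blast
        then have "b * s + y > 0" using bd(2) 4 by smt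
        then have *: "t = 1" using st unfolding E by blast
        have "x > - a \<or> x < - a" using nz by linarith
        then have "s = of_bool (x > - a)"
        proof
          assume c: "x > - a"
          then have "a * t + x > 0" using * by simp
          then have "s = 1" using st unfolding E by blast
          with c show ?thesis by simp
        next
          assume c: "x < - a"
          then have "a * t + x < 0" using * by simp
          then have "s = 0" using st unfolding E by blast
          with c show ?thesis by simp
        qed
        with * show "s = of_bool (x > - a) \<and> t = of_bool True" by simp
      next
        show "(of_bool (x > - a), of_bool True) \<in> E"
          unfolding E using 4 nz ab by (cases "x > - a") simp_all
      qed
    qed
  qed
  then obtain p q where pq: "E = {(of_bool p, of_bool q)}" by blast
  show ?thesis
  proof (rule ex1I[of _ "(p, q)"])
    show "mixed_equilibria \<theta> v = {(of_bool (fst (p, q)), of_bool (snd (p, q)))}"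
      using pq by (simp add: E_def)
    show "z = (p, q)" if "mixed_equilibria \<theta> v = {(of_bool (fst z), of_bool (snd z))}" for z
      using pq that by (auto simp: E_def prod_eq_iff of_bool_def split: if_splits)
  qed
qed

lemma pure_equilibrium_exists:
  assumes "fst \<theta> < 0" "snd \<theta> < 0"
  shows "\<exists>y\<in>set profiles. pure_equilibrium \<theta> v y"
proof -
  have iff: "pure_equilibrium \<theta> v (p, q) \<longleftrightarrow>
      (if p then 0 \<le> fst \<theta> * of_bool q + fst v else fst \<theta> * of_bool q + fst v \<le> 0) \<and>
      (if q then 0 \<le> snd \<theta> * of_bool p + snd v else snd \<theta> * of_bool p + snd v \<le> 0)" for p q
    unfolding pure_equilibrium_def payoff_def prod.case all_bool_eq by (cases p; cases q) simp_all
  have "pure_equilibrium \<theta> v (False, False) \<or> pure_equilibrium \<theta> v (True, False) \<or>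
      pure_equilibrium \<theta> v (False, True) \<or> pure_equilibrium \<theta> v (True, True)"
    unfolding iff if_True if_False of_bool_eq using assms by argo
  then show ?thesis by (auto simp: profiles_def)
qed

lemma mixed_equilibria_cell:
  assumes "fst \<theta> < 0" "snd \<theta> < 0" "v \<notin> null_set \<theta>" "v \<in> mult_cell \<theta>"
  shows "mixed_equilibria \<theta> v = {(1, 0), (0, 1), mix_probs \<theta> v}"
proof -
  obtain a b where \<theta>: "\<theta> = (a, b)" by (cases \<theta>)
  obtain x y where v: "v = (x, y)" by (cases v)
  have ab: "a < 0" "b < 0" using assms \<theta> by auto
  have cell: "0 < x" "x < - a" "0 < y" "y < - b"
    using assms(3,4) by (auto simp: null_set_def mult_cell_def \<theta> v)
  have br1: "a * t + x > 0 \<longleftrightarrow> t < x / (- a)" "a * t + x < 0 \<longleftrightarrow> t > x / (- a)" for t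
    using ab by (auto simp: field_simps)
  have br2: "b * s + y > 0 \<longleftrightarrow> s < y / (- b)" "b * s + y < 0 \<longleftrightarrow> s > y / (- b)" for s
    using ab by (auto simp: field_simps)
  have r: "0 < x / (- a)" "x / (- a) < 1" "0 < y / (- b)" "y / (- b) < 1"
    using ab cell by (simp_all add: field_simps)
  define p q where "p = x / (- a)" and "q = y / (- b)"
  have "(s, t) \<in> mixed_equilibria \<theta> v \<longleftrightarrow> (s, t) \<in> {(1, 0), (0, 1), (q, p)}" for s t
    using r unfolding mixed_equilibria_iff \<theta> v fst_conv snd_conv br1 br2
      p_def[symmetric] q_def[symmetric]
    by (cases t p rule: linorder_cases; cases s q rule: linorder_cases) auto
  moreover have "mix_probs \<theta> v = (q, p)"
    by (simp add: mix_probs_def \<theta> v p_def q_def)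
  ultimately show ?thesis by (simp only: set_eq_iff split_paired_all simp_thms) simp
qed

end

theory Submission
  imports Defs
begin

text \<open>Outside the open multiplicity cell \<open>C\<close> the kernel does not depend on the selector, so a law in
  \<open>Gam\<close> matters only through the masses \<open>u\<close> and \<open>w\<close> that it gives to the two pure equilibria on
  \<open>C\<close> and through the integral \<open>c\<close> of the mixed equilibrium over the event that it is selected.
  These satisfy \<open>u, w \<ge> 0\<close>, a total mass condition, and
  \<open>p \<bullet> c \<le> E[max 0 (p \<bullet> qmix(V)); V \<in> C]\<close> for all \<open>p\<close>, conditions that define a compact set.

  Conversely every such triple comes from a selection without randomisation. Minimise the convex
  function \<open>p \<mapsto> E[max 0 (V\<^sub>2\<^sup>2 + p \<bullet> qmix(V)); V \<in> C] - p \<bullet> c\<close>; its first-order condition says that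
  \<open>c\<close> is the integral of \<open>qmix\<close> over the set where \<open>V\<^sub>2\<^sup>2 + p \<bullet> qmix(V) > 0\<close>. Differentiability and
  coercivity rest on the fact that the polynomials involved vanish only on null sets. The
  remainder of the cell is split in the same way into two parts of masses \<open>u\<close> and \<open>w\<close>.\<close>

subsection \<open>Attaining the points of a zonoid\<close>

text \<open>First-order condition: the derivative of \<open>max 0\<close> is an indicator almost everywhere,
  because \<open>f\<close> has no mass at its kink.\<close>

lemma mean_at_minimum:
  fixes g :: "'a \<Rightarrow> 'b::euclidean_space" and f :: "'a \<Rightarrow> real"
  assumes g: "integrable M g" and f: "integrable M f" and nz: "AE x in M. f x \<noteq> 0"
    and min: "\<And>e. (LINT x|M. max 0 (f x)) \<le> (LINT x|M. max 0 (f x + e \<bullet> g x)) - e \<bullet> c"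
  shows "c = (LINT x|M. indicator {x. 0 < f x} x *\<^sub>R g x)"
proof -
  define I where "I = (LINT x|M. indicator {x. 0 < f x} x *\<^sub>R g x)"
  have [measurable]: "g \<in> borel_measurable M" "f \<in> borel_measurable M" using g f by auto
  have intI: "integrable M (\<lambda>x. indicator {x. 0 < f x} x *\<^sub>R g x)"
    by (rule Bochner_Integration.integrable_bound[OF g]) (auto split: split_indicator)
  \<comment> \<open>An inequality in every direction \<open>e\<close> suffices: choosing
    \<open>e = c - I\<close> at the end makes the squared norm of \<open>c - I\<close>
    nonpositive.\<close>
  have "e \<bullet> c \<le> e \<bullet> I" for e
  proof -
    \<comment> \<open>\<open>u n\<close> is the difference quotient of \<open>max 0\<close> at
      \<open>f\<close> along \<open>e \<bullet> g\<close>, with step 1/(n+1). Since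
      \<open>max 0\<close> is 1-Lipschitz, it is dominated by
      \<open>\<bar>e \<bullet> g x\<bar>\<close>.\<close>
    define u where "u n x = (max 0 (f x + (e /\<^sub>R real (Suc n)) \<bullet> g x) - max 0 (f x)) * real (Suc n)" for n x
    have lim: "(\<lambda>n. LINT x|M. u n x) \<longlonglongrightarrow> (LINT x|M. indicator {x. 0 < f x} x * (e \<bullet> g x))"
    proof (rule integral_dominated_convergence[where w="\<lambda>x. \<bar>e \<bullet> g x\<bar>"])
      show "integrable M (\<lambda>x. \<bar>e \<bullet> g x\<bar>)" using g by auto
      show "u n \<in> borel_measurable M" for n unfolding u_def by measurable
      show "AE x in M. (\<lambda>n. u n x) \<longlonglongrightarrow> indicator {x. 0 < f x} x * (e \<bullet> g x)"
        using nz
      proof eventually_elim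
        fix x assume fx: "f x \<noteq> 0"
        have "(\<lambda>n. (e \<bullet> g x) * inverse (real (Suc n))) \<longlonglongrightarrow> (e \<bullet> g x) * 0"
          by (intro tendsto_intros LIMSEQ_inverse_real_of_nat)
        then have "(\<lambda>n. (e /\<^sub>R real (Suc n)) \<bullet> g x) \<longlonglongrightarrow> 0"
          by (simp add: mult.commute)
        \<comment> \<open>Once the increment is smaller than \<open>\<bar>f x\<bar>\<close>, it
          cannot change the sign of \<open>f x\<close>, so the quotient is eventually constant and
          equal to its limit.\<close>
        then have "\<forall>\<^sub>F n in sequentially. \<bar>(e /\<^sub>R real (Suc n)) \<bullet> g x\<bar> < \<bar>f x\<bar>"
          using order_tendstoD(2)[OF tendsto_rabs] fx by fastforce
        then have "\<forall>\<^sub>F n in sequentially. u n x = indicator {x. 0 < f x} x * (e \<bullet> g x)"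
        proof eventually_elim
          case (elim n)
          show ?case
          proof (cases "0 < f x")
            case True
            then have "u n x = ((e /\<^sub>R real (Suc n)) \<bullet> g x) * real (Suc n)"
              using elim unfolding u_def by (simp add: max_def)
            then show ?thesis using True by simp
          next
            case False
            then have "f x + (e /\<^sub>R real (Suc n)) \<bullet> g x \<le> 0" using elim by linarith
            then have "u n x = 0" using False unfolding u_def by (simp add: max_absorb1)
            then show ?thesis using False by simp
          qed
        qed
        then show "(\<lambda>n. u n x) \<longlonglongrightarrow> indicator {x. 0 < f x} x * (e \<bullet> g x)"
          by (rule tendsto_eventually)
      qed
      show "AE x in M. norm (u n x) \<le> \<bar>e \<bullet> g x\<bar>" for n
      proof (rule AE_I2)
        fix x
        have "\<bar>max 0 (f x + (e /\<^sub>R real (Suc n)) \<bullet> g x) - max 0 (f x)\<bar>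
            \<le> \<bar>(e /\<^sub>R real (Suc n)) \<bullet> g x\<bar>" by linarith
        then have "norm (u n x) \<le> \<bar>(e /\<^sub>R real (Suc n)) \<bullet> g x\<bar> * real (Suc n)"
          unfolding u_def real_norm_def abs_mult abs_of_nat by (rule mult_right_mono) simp
        also have "\<dots> = \<bar>e \<bullet> g x\<bar>" by (simp add: abs_mult)
        finally show "norm (u n x) \<le> \<bar>e \<bullet> g x\<bar>" .
      qed
    qed measurable
    \<comment> \<open>Minimality bounds every difference quotient, after integration, from below by
      \<open>e \<bullet> c\<close>; the bound then passes to the limit.\<close>
    have "e \<bullet> c \<le> (LINT x|M. u n x)" for n
    proof -
      have i: "integrable M (\<lambda>x. max 0 (f x + (e /\<^sub>R real (Suc n)) \<bullet> g x))"
        "integrable M (\<lambda>x. max 0 (f x))"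
        using g f by auto
      have "(LINT x|M. u n x) = ((LINT x|M. max 0 (f x + (e /\<^sub>R real (Suc n)) \<bullet> g x))
          - (LINT x|M. max 0 (f x))) * real (Suc n)"
        unfolding u_def using i by simp
      moreover have "((e /\<^sub>R real (Suc n)) \<bullet> c) * real (Suc n) \<le> \<dots>"
        using min[of "e /\<^sub>R real (Suc n)"] by (intro mult_right_mono) auto
      moreover have "((e /\<^sub>R real (Suc n)) \<bullet> c) * real (Suc n) = e \<bullet> c" by simp
      ultimately show ?thesis by linarith
    qed
    then have "e \<bullet> c \<le> (LINT x|M. indicator {x. 0 < f x} x * (e \<bullet> g x))"
      using lim by (intro LIMSEQ_le_const) auto
    also have "\<dots> = e \<bullet> I"
      unfolding I_def using intI by (subst integral_inner_right[symmetric]) auto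
    finally show ?thesis .
  qed
  from this[of "c - I"] have "(c - I) \<bullet> (c - I) \<le> 0" by (simp add: inner_diff_right)
  then have "(c - I) \<bullet> (c - I) = 0" by (intro antisym) auto
  then show ?thesis unfolding I_def[symmetric] by simp
qed

text \<open>Because \<open>max 0\<close> is 1-Lipschitz, the integral is Lipschitz in
  \<open>p\<close> with constant the integral of \<open>norm (g x)\<close>. This makes minimisation
  over compact sets possible.\<close>

lemma continuous_integral_positive_part:
  fixes g :: "'a \<Rightarrow> 'b::euclidean_space" and h :: "'a \<Rightarrow> real"
  assumes g: "integrable M g" and h: "integrable M h"
  shows "continuous_on UNIV (\<lambda>p. LINT x|M. max 0 (h x + p \<bullet> g x))"
proof (rule lipschitz_on_continuous_on[where L="LINT x|M. norm (g x)"], rule lipschitz_onI)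
  fix p q :: 'b
  have i: "integrable M (\<lambda>x. max 0 (h x + r \<bullet> g x))" for r using g h by auto
  have "\<bar>(LINT x|M. max 0 (h x + p \<bullet> g x)) - (LINT x|M. max 0 (h x + q \<bullet> g x))\<bar>
      = \<bar>LINT x|M. max 0 (h x + p \<bullet> g x) - max 0 (h x + q \<bullet> g x)\<bar>"
    using i by simp
  also have "\<dots> \<le> (LINT x|M. \<bar>max 0 (h x + p \<bullet> g x) - max 0 (h x + q \<bullet> g x)\<bar>)"
    by (rule integral_abs_bound)
  also have "\<dots> \<le> (LINT x|M. norm (g x) * norm (p - q))"
  proof (rule integral_mono)
    fix x
    have "\<bar>max 0 (h x + p \<bullet> g x) - max 0 (h x + q \<bullet> g x)\<bar> \<le> \<bar>(p - q) \<bullet> g x\<bar>"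
      by (simp add: inner_diff_left)
    also have "\<dots> \<le> norm (g x) * norm (p - q)"
      by (metis Cauchy_Schwarz_ineq2 mult.commute)
    finally show "\<bar>max 0 (h x + p \<bullet> g x) - max 0 (h x + q \<bullet> g x)\<bar> \<le> norm (g x) * norm (p - q)" .
  qed (use i g in auto)
  finally show "dist (LINT x|M. max 0 (h x + p \<bullet> g x)) (LINT x|M. max 0 (h x + q \<bullet> g x))
      \<le> (LINT x|M. norm (g x)) * dist p q"
    by (simp add: dist_norm)
qed (simp add: integral_nonneg_AE)

text \<open>A substitute for Lyapunov's convexity theorem: \<open>c\<close> is read off the first-order condition at a
  minimum of \<open>F\<close>. The minimum exists unless the positively homogeneous part \<open>R\<close> of \<open>F\<close> vanishes
  at some unit vector, and then this vector minimises \<open>R\<close>, whose first-order condition is used instead.\<close>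

lemma zonoid_point_attained:
  fixes g :: "'a \<Rightarrow> 'b::euclidean_space" and h :: "'a \<Rightarrow> real"
  assumes g: "integrable M g" and h: "integrable M h"
    and nz: "\<And>p. p \<noteq> 0 \<Longrightarrow> AE x in M. p \<bullet> g x \<noteq> 0"
    and nzh: "\<And>p. AE x in M. h x + p \<bullet> g x \<noteq> 0"
    and c: "\<And>p. p \<bullet> c \<le> (LINT x|M. max 0 (p \<bullet> g x))"
  shows "\<exists>A\<in>sets M. c = (LINT x|M. indicator A x *\<^sub>R g x)"
proof -
  have meas [measurable]: "g \<in> borel_measurable M" "h \<in> borel_measurable M" using g h by auto
  have attained: ?thesis
    if f: "integrable M f" "AE x in M. f x \<noteq> 0"
      and min: "\<And>e. (LINT x|M. max 0 (f x)) \<le> (LINT x|M. max 0 (f x + e \<bullet> g x)) - e \<bullet> c"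
    for f
  proof (rule bexI)
    have [measurable]: "f \<in> borel_measurable M" using f by auto
    show "{x \<in> space M. 0 < f x} \<in> sets M" by measurable
    have "c = (LINT x|M. indicator {x. 0 < f x} x *\<^sub>R g x)"
      using mean_at_minimum[OF g f min] .
    also have "\<dots> = (LINT x|M. indicator {x \<in> space M. 0 < f x} x *\<^sub>R g x)"
      by (rule Bochner_Integration.integral_cong) (auto split: split_indicator)
    finally show "c = (LINT x|M. indicator {x \<in> space M. 0 < f x} x *\<^sub>R g x)" .
  qed
  define R where "R p = (LINT x|M. max 0 (p \<bullet> g x)) - p \<bullet> c" for p
  define F where "F p = (LINT x|M. max 0 (h x + p \<bullet> g x)) - p \<bullet> c" for p
  have R0: "0 \<le> R p" for p using c[of p] by (simp add: R_def)
  have ip: "integrable M (\<lambda>x. p \<bullet> g x)" "integrable M (\<lambda>x. h x + p \<bullet> g x)" for p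
    using g h by auto
  show ?thesis
  proof (cases "\<exists>p\<in>sphere 0 1. R p = 0")
    case True
    then obtain p where p: "norm p = 1" "R p = 0" by auto
    show ?thesis
    proof (rule attained)
      show "integrable M (\<lambda>x. p \<bullet> g x)" by (rule ip)
      show "AE x in M. p \<bullet> g x \<noteq> 0" using p by (intro nz) auto
      \<comment> \<open>Hypothesis \<open>c\<close> says that \<open>R\<close> is nonnegative
        everywhere, so a zero of \<open>R\<close> is a global minimum.\<close>
      show "(LINT x|M. max 0 (p \<bullet> g x)) \<le> (LINT x|M. max 0 (p \<bullet> g x + e \<bullet> g x)) - e \<bullet> c" for e
        using R0[of "p + e"] p(2) by (simp add: R_def inner_add_left)
    qed
  next
    case False
    have contR: "continuous_on UNIV R"
      using continuous_integral_positive_part[OF g, of "\<lambda>_. 0"] unfolding R_def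
      by (intro continuous_intros) simp_all
    have contF: "continuous_on UNIV F"
      using continuous_integral_positive_part[OF g h] unfolding F_def
      by (intro continuous_intros)
    obtain p0 where p0: "p0 \<in> sphere 0 1" "\<And>p. p \<in> sphere 0 1 \<Longrightarrow> R p0 \<le> R p"
      using continuous_attains_inf[of "sphere 0 1" R] continuous_on_subset[OF contR] by auto
    define m where "m = R p0"
    have m: "0 < m" using R0[of p0] False p0(1) by (force simp: m_def)
    \<comment> \<open>By homogeneity, the positive minimum \<open>m\<close> on the unit sphere
      becomes linear growth of \<open>R\<close> at infinity.\<close>
    have R_ge: "m * norm p \<le> R p" for p
    proof (cases "p = 0")
      case False
      have "R p = norm p * R (p /\<^sub>R norm p)"
      proof -
        have "max 0 (p \<bullet> g x) = norm p * max 0 ((p /\<^sub>R norm p) \<bullet> g x)" for x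
          using False by (simp add: max_mult_distrib_left mult.assoc[symmetric])
        then have "(LINT x|M. max 0 (p \<bullet> g x)) = norm p * (LINT x|M. max 0 ((p /\<^sub>R norm p) \<bullet> g x))"
          by simp
        then show ?thesis using False by (simp add: R_def right_diff_distrib)
      qed
      moreover have "m \<le> R (p /\<^sub>R norm p)" using False unfolding m_def by (intro p0) auto
      ultimately show ?thesis using False by (simp add: mult.commute)
    qed (simp add: R_def)
    define K where "K = (LINT x|M. \<bar>h x\<bar>)"
    have K0: "0 \<le> K" by (simp add: K_def)
    \<comment> \<open>Adding \<open>h x\<close> inside \<open>max 0\<close> lowers it by at most
      \<open>\<bar>h x\<bar>\<close>, so \<open>F\<close> inherits the growth of \<open>R\<close> up
      to the constant \<open>K\<close>.\<close>
    have F_ge: "m * norm p - K \<le> F p" for p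
    proof -
      have "(LINT x|M. max 0 (p \<bullet> g x) - \<bar>h x\<bar>) \<le> (LINT x|M. max 0 (h x + p \<bullet> g x))"
        using ip g h by (intro integral_mono) auto
      then have "R p - K \<le> F p" using ip g h by (simp add: R_def F_def K_def)
      then show ?thesis using R_ge[of p] by linarith
    qed
    \<comment> \<open>Beyond radius \<open>r\<close> the lower bound \<open>m * norm p - K\<close>
      exceeds \<open>K\<close>, which is at least \<open>F 0\<close>. The minimum over the ball is
      therefore global.\<close>
    define r where "r = 2 * K / m"
    have "0 \<le> r" using K0 m by (simp add: r_def)
    obtain q where q: "q \<in> cball 0 r" "\<And>p. p \<in> cball 0 r \<Longrightarrow> F q \<le> F p"
      using continuous_attains_inf[of "cball 0 r" F] continuous_on_subset[OF contF] \<open>0 \<le> r\<close> by auto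
    have F0: "F 0 \<le> K" unfolding F_def K_def using h by (simp, intro integral_mono) auto
    have qmin: "F q \<le> F p" for p
    proof (cases "norm p \<le> r")
      case False
      then have "2 * K < m * norm p" using m by (simp add: r_def field_simps)
      then have "F 0 < F p" using F_ge[of p] F0 by linarith
      moreover have "F q \<le> F 0" using \<open>0 \<le> r\<close> by (intro q) auto
      ultimately show ?thesis by linarith
    qed (use q in auto)
    show ?thesis
    proof (rule attained)
      show "integrable M (\<lambda>x. h x + q \<bullet> g x)" by (rule ip)
      show "AE x in M. h x + q \<bullet> g x \<noteq> 0" by (rule nzh)
      show "(LINT x|M. max 0 (h x + q \<bullet> g x)) \<le> (LINT x|M. max 0 (h x + q \<bullet> g x + e \<bullet> g x)) - e \<bullet> c" for e
        using qmin[of "q + e"] by (simp add: F_def inner_add_left add.assoc)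
    qed
  qed
qed

subsection \<open>Errors, equilibria and the kernel\<close>

lemma borel_measurable_fst_snd [measurable]:
  "(fst :: real \<times> real \<Rightarrow> real) \<in> borel_measurable borel"
  "(snd :: real \<times> real \<Rightarrow> real) \<in> borel_measurable borel"
  by (metis borel_prod measurable_fst, metis borel_prod measurable_snd)

text \<open>A nonzero polynomial has finitely many roots, and the normal law has a density. All
  genericity claims about the errors reduce to this.\<close>

lemma quadratic_nonzero_AE:
  fixes k :: real
  assumes "k \<noteq> 0 \<or> b \<noteq> 0 \<or> a \<noteq> 0"
  shows "AE y in density lborel std_normal_density. a + b * y + k * y\<^sup>2 \<noteq> 0"
proof -
  have "finite {y. poly [:a, b, k:] y = 0}"
    using assms by (intro poly_roots_finite) auto
  then have "AE y in lborel. poly [:a, b, k:] y \<noteq> 0"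
    using AE_not_in[OF finite_imp_null_set_lborel] by force
  then have "AE y in lborel. a + b * y + k * y\<^sup>2 \<noteq> 0"
    by eventually_elim (simp add: algebra_simps power2_eq_square)
  then show ?thesis by (subst AE_density) auto
qed

lemma sets_errH [measurable_cong, simp]: "sets errH = sets borel"
  unfolding errH_def borel_prod[symmetric] by (intro sets_pair_measure_cong) simp_all

lemma space_errH [simp]: "space errH = UNIV"
  using sets_eq_imp_space_eq[OF sets_errH] by simp

lemma prob_space_errH: "prob_space errH"
  unfolding errH_def
  by (intro prob_space_pair prob_space_normal_density) simp_all

lemma AE_errH:
  assumes "AE x in density lborel std_normal_density.
      AE y in density lborel std_normal_density. P (x, y)"
    and [measurable]: "Measurable.pred borel P"
  shows "AE v in errH. P v"
proof -
  interpret N: prob_space "density lborel std_normal_density"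
    by (rule prob_space_normal_density) simp
  interpret pair_sigma_finite "density lborel std_normal_density" "density lborel std_normal_density" ..
  have "{v \<in> space errH. P v} \<in> sets errH" by measurable
  then show ?thesis
    unfolding errH_def using assms(1) by (intro AE_pair_measure)
qed

lemma profile_sum: "(\<Sum>y\<in>(UNIV :: profile set). f y) =
    f (False, False) + f (True, False) + f (False, True) + (f (True, True) :: real)"
proof -
  have "(UNIV :: profile set) = {(False, False), (True, False), (False, True), (True, True)}"
    by auto
  then have "sum f UNIV = sum f {(False, False), (True, False), (False, True), (True, True)}"
    by (rule arg_cong)
  then show ?thesis by simp
qed

lemma dist4_eq_iff: "(p :: dist4) = q \<longleftrightarrow> p $ (False, False) = q $ (False, False) \<and>
    p $ (True, False) = q $ (True, False) \<and> p $ (False, True) = q $ (False, True) \<and>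
    p $ (True, True) = q $ (True, True)"
  by (auto simp: vec_eq_iff split_paired_all all_bool_eq)

text \<open>Removing \<open>null_set\<close> deletes the lower edges contained in
  \<open>mult_cell\<close>. The kernel tests \<open>null_set\<close> first, so this is exactly where
  the selector matters.\<close>

definition open_cell :: "real \<times> real \<Rightarrow> (real \<times> real) set" where
  "open_cell \<theta> = mult_cell \<theta> - null_set \<theta>"

lemma null_set_borel [measurable]: "null_set \<theta> \<in> sets borel"
proof -
  have "null_set \<theta> = {0, - fst \<theta>} \<times> UNIV \<union> UNIV \<times> {0, - snd \<theta>}"
    by (auto simp: null_set_def)
  also have "\<dots> \<in> sets borel"
    by (intro sets.Un borel_closed closed_Times) auto
  finally show ?thesis .
qed

lemma open_cell_borel [measurable]: "open_cell \<theta> \<in> sets borel"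
proof -
  have "mult_cell \<theta> \<in> sets (borel \<Otimes>\<^sub>M borel)"
    unfolding mult_cell_def by measurable
  then show ?thesis unfolding open_cell_def borel_prod by measurable
qed

lemma null_set_AE: "AE v in errH. v \<notin> null_set \<theta>"
proof (rule AE_errH)
  have *: "AE y in density lborel std_normal_density. y \<noteq> c" for c :: real
    using quadratic_nonzero_AE[of 0 1 "- c"] by simp
  show "AE x in density lborel std_normal_density. AE y in density lborel std_normal_density.
      (x, y) \<notin> null_set \<theta>"
    using *[of 0] *[of "- fst \<theta>"]
  proof eventually_elim
    case x: (elim x)
    show ?case using *[of 0] *[of "- snd \<theta>"]
      by eventually_elim (use x in \<open>auto simp: null_set_def\<close>)
  qed
qed measurable

definition mix_dist :: "real \<times> real \<Rightarrow> real \<times> real \<Rightarrow> dist4" where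
  "mix_dist \<theta> v = product_dist (mix_probs \<theta> v)"

lemma borel_measurable_dist4:
  fixes f :: "'a \<Rightarrow> dist4"
  assumes "\<And>y. (\<lambda>x. f x $ y) \<in> borel_measurable M"
  shows "f \<in> borel_measurable M"
  using assms
  by (subst borel_measurable_euclidean_space) (auto simp: Basis_vec_def inner_axis)

lemma measurable_vec_nth' [measurable (raw)]:
  fixes f :: "'a \<Rightarrow> dist4"
  assumes "f \<in> borel_measurable M"
  shows "(\<lambda>x. f x $ y) \<in> borel_measurable M"
  using borel_measurable_continuous_onI[of "\<lambda>x::dist4. x $ y"] assms
  by (intro measurable_compose[OF assms]) (auto intro: continuous_intros)

lemma mix_dist_measurable [measurable]: "mix_dist \<theta> \<in> borel_measurable borel"
proof (rule borel_measurable_dist4)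
  show "(\<lambda>v. mix_dist \<theta> v $ y) \<in> borel_measurable borel" for y
    unfolding mix_dist_def mix_probs_def product_dist_def borel_prod[symmetric]
    by (cases y) simp
qed

lemma prob_vecsD: "p \<in> prob_vecs \<Longrightarrow> 0 \<le> p $ y" "p \<in> prob_vecs \<Longrightarrow> (\<Sum>y\<in>UNIV. p $ y) = 1"
  unfolding prob_vecs_def mem_Collect_eq by blast+

lemma product_dist_prob:
  assumes "fst s \<in> {0..1}" "snd s \<in> {0..1}"
  shows "product_dist s \<in> prob_vecs"
proof -
  have "0 \<le> (if fst y then a else 1 - a) * (if snd y then b else 1 - b)"
    if "a \<in> {0..1}" "b \<in> {0..1}" for a b :: real and y :: profile
    using that by (intro mult_nonneg_nonneg) auto
  then show ?thesis
    using assms unfolding prob_vecs_def product_dist_def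
    by (cases s) (simp add: profile_sum algebra_simps)
qed

lemma prob_vecs_norm:
  assumes "p \<in> prob_vecs" shows "norm p \<le> 1"
proof -
  have "norm p \<le> (\<Sum>y\<in>UNIV. \<bar>p $ y\<bar>)" by (rule norm_le_l1_cart)
  also have "\<dots> = 1" using prob_vecsD[OF assms] by simp
  finally show ?thesis .
qed

lemma mixed_equilibria_product_prob:
  "s \<in> mixed_equilibria \<theta> v \<Longrightarrow> product_dist s \<in> prob_vecs"
  by (cases s) (auto simp: mixed_equilibria_def intro!: product_dist_prob)

lemma Q_subset_prob: "Q \<theta> v \<subseteq> prob_vecs"
  unfolding Q_def using mixed_equilibria_product_prob by blast

lemma product_dist_of_bool: "product_dist (of_bool p, of_bool q) = point_mass (p, q)"
  by (cases p; cases q) (simp_all add: dist4_eq_iff product_dist_def point_mass_def)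

text \<open>For fixed \<open>x\<close> the expression is a polynomial in \<open>y\<close> of degree
  at most two. With \<open>k \<noteq> 0\<close> it is never the zero polynomial; with
  \<open>k = 0\<close> its remaining coefficients are affine in \<open>x\<close> and vanish together
  only on a null set of \<open>x\<close>, because \<open>p \<noteq> 0\<close>. The case
  \<open>k = 0\<close> serves the homogeneous part in \<open>zonoid_point_attained\<close>, and
  \<open>k = 1\<close> the perturbed function.\<close>

lemma mix_dist_inner_nonzero_AE:
  assumes \<theta>: "fst \<theta> < 0" "snd \<theta> < 0" and p: "p \<noteq> 0 \<or> k \<noteq> 0"
  shows "AE v in errH. k * (snd v)\<^sup>2 + p \<bullet> mix_dist \<theta> v \<noteq> 0"
proof (rule AE_errH)
  \<comment> \<open>\<open>\<alpha> x\<close> and \<open>\<beta> x\<close> are the values of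
    \<open>p \<bullet> mix_dist\<close> at \<open>y = 0\<close> and
    \<open>y = - snd \<theta>\<close>, where firm 1 enters with probability 0 and 1; in between it
    is affine in \<open>y\<close>.\<close>
  define \<alpha> where "\<alpha> x = p $ (False, False) + (p $ (False, True) - p $ (False, False)) / (- fst \<theta>) * x" for x
  define \<beta> where "\<beta> x = p $ (True, False) + (p $ (True, True) - p $ (True, False)) / (- fst \<theta>) * x" for x
  have eq: "k * y\<^sup>2 + p \<bullet> mix_dist \<theta> (x, y) = \<alpha> x + (\<beta> x - \<alpha> x) / (- snd \<theta>) * y + k * y\<^sup>2" for x y
    using \<theta> unfolding inner_vec_def profile_sum \<alpha>_def \<beta>_def mix_dist_def product_dist_def mix_probs_def
    by (simp add: field_simps)
  have "AE x in density lborel std_normal_density. k \<noteq> 0 \<or> \<alpha> x \<noteq> 0 \<or> \<beta> x \<noteq> 0"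
  proof (cases "k = 0")
    case True
    then have "p \<noteq> 0" using p by simp
    then have "(p $ (False, False) \<noteq> 0 \<or> p $ (False, True) \<noteq> 0) \<or>
        (p $ (True, False) \<noteq> 0 \<or> p $ (True, True) \<noteq> 0)"
      by (auto simp: dist4_eq_iff)
    then show ?thesis
    proof
      assume a: "p $ (False, False) \<noteq> 0 \<or> p $ (False, True) \<noteq> 0"
      have "AE x in density lborel std_normal_density. \<alpha> x \<noteq> 0"
        using quadratic_nonzero_AE[of 0 "(p $ (False, True) - p $ (False, False)) / (- fst \<theta>)" "p $ (False, False)"]
          a \<theta> by (auto simp: \<alpha>_def)
      then show ?thesis by eventually_elim simp
    next
      assume a: "p $ (True, False) \<noteq> 0 \<or> p $ (True, True) \<noteq> 0"
      have "AE x in density lborel std_normal_density. \<beta> x \<noteq> 0"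
        using quadratic_nonzero_AE[of 0 "(p $ (True, True) - p $ (True, False)) / (- fst \<theta>)" "p $ (True, False)"]
          a \<theta> by (auto simp: \<beta>_def)
      then show ?thesis by eventually_elim simp
    qed
  qed simp
  then show "AE x in density lborel std_normal_density. AE y in density lborel std_normal_density.
      k * (snd (x, y))\<^sup>2 + p \<bullet> mix_dist \<theta> (x, y) \<noteq> 0"
  proof eventually_elim
    case (elim x)
    show ?case unfolding snd_conv eq
      by (rule quadratic_nonzero_AE) (use elim \<theta> in auto)
  qed
  show "Measurable.pred borel (\<lambda>v. k * (snd v)\<^sup>2 + p \<bullet> mix_dist \<theta> v \<noteq> 0)"
    by measurable
qed

text \<open>The tie-breaking rule that the kernel uses on \<open>null_set\<close>, here applied at
  every \<open>v\<close>. Outside the cell it also returns the unique equilibrium, so one measurable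
  formula replaces the definite description in \<open>unique_profile\<close>.\<close>

definition pure_profile :: "real \<times> real \<Rightarrow> real \<times> real \<Rightarrow> profile" where
  "pure_profile \<theta> v = the (find (pure_equilibrium \<theta> v) profiles)"

lemma pure_equilibrium_iff:
  "pure_equilibrium \<theta> v (p, q) \<longleftrightarrow> (of_bool p, of_bool q) \<in> mixed_equilibria \<theta> v"
  unfolding mixed_equilibria_iff pure_equilibrium_def payoff_def prod.case all_bool_eq
  by (cases p; cases q) auto

lemma pure_equilibrium_pure_profile:
  assumes "fst \<theta> < 0" "snd \<theta> < 0"
  shows "pure_equilibrium \<theta> v (pure_profile \<theta> v)"
proof -
  have "find (pure_equilibrium \<theta> v) profiles \<noteq> None"
    using pure_equilibrium_exists[OF assms, of v] by (auto simp: find_None_iff)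
  then obtain y where y: "find (pure_equilibrium \<theta> v) profiles = Some y" by auto
  then have "pure_equilibrium \<theta> v y" by (auto simp: find_Some_iff)
  then show ?thesis by (simp add: pure_profile_def y)
qed

lemma measurable_pure_profile:
  "pure_profile \<theta> \<in> measurable borel (count_space UNIV)"
proof -
  have [measurable]: "Measurable.pred borel (\<lambda>v. pure_equilibrium \<theta> v (p, q))" for p q
    unfolding pure_equilibrium_iff mixed_equilibria_iff by measurable
  show ?thesis
    unfolding pure_profile_def profiles_def find.simps if_distrib[of the] option.sel
    by measurable
qed

lemma pure_profile_equilibrium:
  assumes "fst \<theta> < 0" "snd \<theta> < 0"
  shows "(of_bool (fst (pure_profile \<theta> v)), of_bool (snd (pure_profile \<theta> v))) \<in> mixed_equilibria \<theta> v"
  using pure_equilibrium_pure_profile[OF assms, of v]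
  by (cases "pure_profile \<theta> v") (simp add: pure_equilibrium_iff)

text \<open>\<open>pure_profile\<close> is always an equilibrium, so where only one equilibrium
  exists it must be that one.\<close>

lemma mixed_equilibria_singleton:
  assumes \<theta>: "fst \<theta> < 0" "snd \<theta> < 0" and v: "v \<notin> null_set \<theta>" "v \<notin> open_cell \<theta>"
  shows "mixed_equilibria \<theta> v = {(of_bool (fst (pure_profile \<theta> v)), of_bool (snd (pure_profile \<theta> v)))}"
    and "unique_profile \<theta> v = pure_profile \<theta> v"
proof -
  have nc: "v \<notin> mult_cell \<theta>" using v by (auto simp: open_cell_def)
  show 1: "mixed_equilibria \<theta> v = {(of_bool (fst (pure_profile \<theta> v)), of_bool (snd (pure_profile \<theta> v)))}"
    using unique_profile_exists[OF \<theta> v(1) nc] pure_profile_equilibrium[OF \<theta>, of v] by auto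
  show "unique_profile \<theta> v = pure_profile \<theta> v"
    unfolding unique_profile_def
    by (rule the1_equality[OF unique_profile_exists[OF \<theta> v(1) nc] 1])
qed

lemma kernel_eq:
  assumes "fst \<theta> < 0" "snd \<theta> < 0"
  shows "kernel \<theta> v s = (if v \<in> open_cell \<theta>
    then if s = 1 then point_mass (True, False) else if s = 2 then point_mass (False, True) else mix_dist \<theta> v
    else point_mass (pure_profile \<theta> v))"
proof (cases "v \<in> null_set \<theta> \<or> v \<in> open_cell \<theta>")
  case True
  then show ?thesis by (auto simp: kernel_def open_cell_def pure_profile_def mix_dist_def)
next
  case False
  then show ?thesis using mixed_equilibria_singleton(2)[OF assms, of v]
    by (auto simp: kernel_def open_cell_def)
qed

lemma Q_open_cell:
  assumes "fst \<theta> < 0" "snd \<theta> < 0" "v \<in> open_cell \<theta>"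
  shows "Q \<theta> v = {point_mass (True, False), point_mass (False, True), mix_dist \<theta> v}"
  using mixed_equilibria_cell[OF assms(1,2), of v] assms(3)
    product_dist_of_bool[of True False] product_dist_of_bool[of False True]
  by (auto simp: Q_def open_cell_def mix_dist_def)

text \<open>The inclusion holds at every \<open>v\<close>, including \<open>null_set\<close>, where
  the tie-breaking profile is an equilibrium. \<open>aumann_expectation\<close> asks for selections
  everywhere, not almost everywhere.\<close>

lemma kernel_in_Q:
  assumes "fst \<theta> < 0" "snd \<theta> < 0"
  shows "kernel \<theta> v s \<in> Q \<theta> v"
proof (cases "v \<in> open_cell \<theta>")
  case True
  then show ?thesis using Q_open_cell[OF assms True] kernel_eq[OF assms, of v s] by auto
next
  case False
  then have "kernel \<theta> v s = product_dist (of_bool (fst (pure_profile \<theta> v)), of_bool (snd (pure_profile \<theta> v)))"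
    using kernel_eq[OF assms, of v s] by (simp add: product_dist_of_bool)
  then show ?thesis using pure_profile_equilibrium[OF assms, of v] by (auto simp: Q_def)
qed

lemma kernel_prob:
  assumes "fst \<theta> < 0" "snd \<theta> < 0"
  shows "kernel \<theta> v s \<in> prob_vecs"
  using kernel_in_Q[OF assms] Q_subset_prob by blast

lemma kernel_measurable:
  assumes "fst \<theta> < 0" "snd \<theta> < 0"
  shows "(\<lambda>v. kernel \<theta> v s) \<in> borel_measurable borel"
proof -
  have [measurable]: "(\<lambda>v. point_mass (pure_profile \<theta> v)) \<in> borel_measurable borel"
    by (rule measurable_compose[OF measurable_pure_profile]) simp
  show ?thesis unfolding kernel_eq[OF assms] by measurable
qed

lemma mix_dist_prob:
  assumes "fst \<theta> < 0" "snd \<theta> < 0" "v \<in> open_cell \<theta>"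
  shows "mix_dist \<theta> v \<in> prob_vecs"
  using Q_open_cell[OF assms] Q_subset_prob[of \<theta> v] by auto

section \<open>Integrals of probability vectors\<close>

lemma integral_vec_nth:
  fixes f :: "'a \<Rightarrow> dist4"
  assumes "integrable M f"
  shows "(LINT x|M. f x) $ y = (LINT x|M. f x $ y)"
  using integral_bounded_linear[OF bounded_linear_vec_nth assms, of y] by simp

lemma integrable_vec_nth:
  fixes f :: "'a \<Rightarrow> dist4"
  assumes "integrable M f"
  shows "integrable M (\<lambda>x. f x $ y)"
  by (rule integrable_bounded_linear[OF bounded_linear_vec_nth assms])

text \<open>Probability vectors lie in the unit ball, which gives integrability; nonnegativity and
  total mass one pass through the integral.\<close>

lemma integral_prob_vecs:
  assumes "prob_space M" and f: "f \<in> borel_measurable M" "\<And>x. x \<in> space M \<Longrightarrow> f x \<in> prob_vecs"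
  shows "integrable M f" "(LINT x|M. f x) \<in> prob_vecs"
proof -
  interpret prob_space M by fact
  show i: "integrable M f"
    using prob_vecs_norm f by (intro integrable_const_bound[where B=1]) auto
  have "(\<Sum>y\<in>UNIV. (LINT x|M. f x) $ y) = (LINT x|M. (\<Sum>y\<in>UNIV. f x $ y))"
    using integrable_vec_nth[OF i] by (subst Bochner_Integration.integral_sum) (auto simp: integral_vec_nth[OF i])
  also have "\<dots> = (LINT x|M. 1)"
    by (rule Bochner_Integration.integral_cong) (auto simp: prob_vecsD f)
  finally have "(\<Sum>y\<in>UNIV. (LINT x|M. f x) $ y) = 1" by (simp add: prob_space)
  moreover have "0 \<le> (LINT x|M. f x) $ y" for y
    unfolding integral_vec_nth[OF i] using prob_vecsD(1)[OF f(2)] by (intro integral_nonneg_AE AE_I2)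
  ultimately show "(LINT x|M. f x) \<in> prob_vecs" unfolding prob_vecs_def by blast
qed

lemma aumann_subset_prob: "aumann_expectation \<theta> \<subseteq> prob_vecs"
proof
  fix p assume "p \<in> aumann_expectation \<theta>"
  then obtain q where p: "p = (LINT v|errH. q v)" and q: "q \<in> borel_measurable borel" "\<And>v. q v \<in> Q \<theta> v"
    unfolding aumann_expectation_def by blast
  have "q \<in> borel_measurable errH" using q(1) by simp
  moreover have "q v \<in> prob_vecs" for v using q(2) Q_subset_prob by blast
  ultimately show "p \<in> prob_vecs" unfolding p using prob_space_errH by (intro integral_prob_vecs)
qed

text \<open>Coordinate sums recover the mass of the weight, so \<open>c\<close> alone determines how
  often the mixed equilibrium is selected. The condition is restricted to
  \<open>a x \<noteq> 0\<close> because \<open>mix_dist\<close> is known to be a probability vector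
  only in the cell.\<close>

lemma sum_integral_scaleR_prob_vecs:
  assumes "integrable M (\<lambda>x. a x *\<^sub>R f x)" and "\<And>x. x \<in> space M \<Longrightarrow> a x \<noteq> 0 \<Longrightarrow> f x \<in> prob_vecs"
  shows "(\<Sum>y\<in>UNIV. (LINT x|M. a x *\<^sub>R f x) $ y) = (LINT x|M. a x)"
proof -
  have "(\<Sum>y\<in>UNIV. (LINT x|M. a x *\<^sub>R f x) $ y) = (LINT x|M. (\<Sum>y\<in>UNIV. (a x *\<^sub>R f x) $ y))"
    using integrable_vec_nth[OF assms(1)]
    by (subst Bochner_Integration.integral_sum) (auto simp: integral_vec_nth[OF assms(1)])
  also have "\<dots> = (LINT x|M. a x)"
  proof (rule Bochner_Integration.integral_cong)
    fix x assume "x \<in> space M"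
    then show "(\<Sum>y\<in>UNIV. (a x *\<^sub>R f x) $ y) = a x"
      using assms(2)[of x] prob_vecsD(2)[of "f x"] by (cases "a x = 0") (auto simp: sum_distrib_left[symmetric])
  qed simp
  finally show ?thesis .
qed

subsection \<open>The compact set of cell weights\<close>

text \<open>The selector value 1 is arbitrary: off the open cell the kernel ignores it.\<close>

definition outside_mean :: "real \<times> real \<Rightarrow> dist4" where
  "outside_mean \<theta> = (LINT v|errH. indicator (- open_cell \<theta>) v *\<^sub>R kernel \<theta> v 1)"

text \<open>The zonoid of all \<open>E[w(V) qmix(V); V \<in> C]\<close> with \<open>0 \<le> w \<le> 1\<close>, described by its support function:
  in this form it is evidently closed.\<close>

definition cell_zonoid :: "real \<times> real \<Rightarrow> dist4 set" where
  "cell_zonoid \<theta> =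
     {c. \<forall>p. p \<bullet> c \<le> (LINT v|errH. indicator (open_cell \<theta>) v * max 0 (p \<bullet> mix_dist \<theta> v))}"

text \<open>The coordinate sum of \<open>c\<close> stands for the mass on which the mixed
  equilibrium is selected, so the equation distributes the cell over the three selectors.\<close>

definition cell_weights :: "real \<times> real \<Rightarrow> (dist4 \<times> real \<times> real) set" where
  "cell_weights \<theta> = {(c, u, w). c \<in> cell_zonoid \<theta> \<and> 0 \<le> u \<and> 0 \<le> w \<and>
     (\<Sum>y\<in>UNIV. c $ y) + u + w = measure errH (open_cell \<theta>)}"

definition assemble :: "real \<times> real \<Rightarrow> dist4 \<times> real \<times> real \<Rightarrow> dist4" where
  "assemble \<theta> = (\<lambda>(c, u, w). outside_mean \<theta> + c + u *\<^sub>R point_mass (True, False)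
     + w *\<^sub>R point_mass (False, True))"

text \<open>Test the support inequality with \<open>p = - axis y 1\<close>: in the cell
  \<open>mix_dist\<close> has nonnegative coordinates, so the positive part on the right
  vanishes.\<close>

lemma cell_zonoid_nonneg:
  assumes "fst \<theta> < 0" "snd \<theta> < 0" "c \<in> cell_zonoid \<theta>"
  shows "0 \<le> c $ y"
proof -
  have "(- axis y 1) \<bullet> c \<le> (LINT v|errH. indicator (open_cell \<theta>) v * max 0 ((- axis y 1) \<bullet> mix_dist \<theta> v))"
    using assms(3) unfolding cell_zonoid_def by blast
  also have "\<dots> = (LINT v|errH. 0)"
  proof (rule Bochner_Integration.integral_cong)
    fix v
    show "indicator (open_cell \<theta>) v * max 0 ((- axis y 1) \<bullet> mix_dist \<theta> v) = (0 :: real)"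
      using prob_vecsD(1)[OF mix_dist_prob[OF assms(1,2), of v], of y]
      by (auto simp: inner_axis' split: split_indicator)
  qed simp
  finally show ?thesis by (simp add: inner_axis')
qed

text \<open>The set is an intersection of closed conditions, \<open>cell_zonoid\<close> being one of
  half-spaces. Nonnegative entries of total at most one bound it.\<close>

lemma compact_cell_weights:
  assumes "fst \<theta> < 0" "snd \<theta> < 0"
  shows "compact (cell_weights \<theta>)"
proof -
  interpret H: prob_space errH by (rule prob_space_errH)
  have "cell_weights \<theta> \<subseteq> cball 0 1"
  proof safe
    fix c u w assume "(c, u, w) \<in> cell_weights \<theta>"
    then have *: "c \<in> cell_zonoid \<theta>" "0 \<le> u" "0 \<le> w" "(\<Sum>y\<in>UNIV. c $ y) + u + w = measure errH (open_cell \<theta>)"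
      by (auto simp: cell_weights_def)
    have "norm (c, u, w) \<le> norm c + (norm u + norm w)"
      by (rule order_trans[OF norm_Pair_le add_left_mono[OF norm_Pair_le]])
    also have "norm c \<le> (\<Sum>y\<in>UNIV. \<bar>c $ y\<bar>)" by (rule norm_le_l1_cart)
    also have "\<dots> = (\<Sum>y\<in>UNIV. c $ y)" using cell_zonoid_nonneg[OF assms *(1)] by simp
    finally have "norm (c, u, w) \<le> (\<Sum>y\<in>UNIV. c $ y) + (\<bar>u\<bar> + \<bar>w\<bar>)" by simp
    then have "norm (c, u, w) \<le> 1" using * H.prob_le_1[of "open_cell \<theta>"] by linarith
    then show "(c, u, w) \<in> cball 0 1" by simp
  qed
  then have "bounded (cell_weights \<theta>)" using bounded_cball bounded_subset by blast
  moreover have "closed (cell_weights \<theta>)"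
  proof -
    have "cell_zonoid \<theta> = (\<Inter>p. {c. p \<bullet> c \<le> (LINT v|errH. indicator (open_cell \<theta>) v * max 0 (p \<bullet> mix_dist \<theta> v))})"
      by (auto simp: cell_zonoid_def)
    then have "closed (cell_zonoid \<theta>)" by (auto intro: closed_halfspace_le)
    moreover have "cell_weights \<theta> = (cell_zonoid \<theta> \<times> UNIV) \<inter> {x. 0 \<le> fst (snd x)} \<inter> {x. 0 \<le> snd (snd x)}
       \<inter> {x. (\<Sum>y\<in>UNIV. fst x $ y) + fst (snd x) + snd (snd x) = measure errH (open_cell \<theta>)}"
      by (auto simp: cell_weights_def)
    ultimately show ?thesis
      by (simp only:) (intro closed_Int closed_Times closed_Collect_le closed_Collect_eq continuous_intros closed_UNIV)
  qed
  ultimately show ?thesis by (simp add: compact_eq_bounded_closed)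
qed

lemma closed_assemble:
  assumes "fst \<theta> < 0" "snd \<theta> < 0"
  shows "closed (assemble \<theta> ` cell_weights \<theta>)"
  unfolding assemble_def case_prod_unfold
  by (intro compact_imp_closed compact_continuous_image compact_cell_weights assms continuous_intros)

section \<open>From cell weights to measurable selections\<close>

lemma integrable_kernel_part:
  assumes "fst \<theta> < 0" "snd \<theta> < 0" and [measurable]: "A \<in> sets borel"
  shows "integrable errH (\<lambda>v. indicator A v *\<^sub>R kernel \<theta> v s)"
proof -
  interpret H: prob_space errH by (rule prob_space_errH)
  have [measurable]: "(\<lambda>v. kernel \<theta> v s) \<in> borel_measurable borel" by (rule kernel_measurable[OF assms(1,2)])
  show ?thesis
    using prob_vecs_norm[OF kernel_prob[OF assms(1,2)]]
    by (intro H.integrable_const_bound[where B=1]) (auto split: split_indicator)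
qed

lemma integrable_mix_part:
  assumes "fst \<theta> < 0" "snd \<theta> < 0" and [measurable]: "A \<in> sets borel" and "A \<subseteq> open_cell \<theta>"
  shows "integrable errH (\<lambda>v. indicator A v *\<^sub>R mix_dist \<theta> v)"
proof -
  interpret H: prob_space errH by (rule prob_space_errH)
  have "norm (indicator A v *\<^sub>R mix_dist \<theta> v) \<le> 1" for v
    using prob_vecs_norm[OF mix_dist_prob[OF assms(1,2), of v]] assms(4)
    by (auto simp del: split_paired_All split: split_indicator)
  then show ?thesis by (intro H.integrable_const_bound[where B=1] AE_I2) auto
qed

lemma AE_restrict_errH:
  assumes "A \<in> sets borel" "AE v in errH. P v"
  shows "AE v in restrict_space errH A. P v"
  using assms by (subst AE_restrict_space_iff) auto

text \<open>Nonatomicity of \<open>errH\<close>, as the one-dimensional case of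
  \<open>zonoid_point_attained\<close> with \<open>g = 1\<close>. Taking \<open>h = snd\<close>
  works because its level sets are null and it is bounded on the cell.\<close>

lemma subset_of_measure:
  assumes D: "D \<in> sets borel" and bnd: "D \<subseteq> open_cell \<theta>" and u: "0 \<le> u" "u \<le> measure errH D"
  shows "\<exists>A\<in>sets borel. A \<subseteq> D \<and> measure errH A = u"
proof -
  interpret H: prob_space errH by (rule prob_space_errH)
  note D [measurable]
  let ?M = "restrict_space errH D"
  have snd_bound: "\<bar>snd v\<bar> \<le> \<bar>snd \<theta>\<bar>" if "v \<in> D" for v
    using that bnd by (auto simp: open_cell_def mult_cell_def)
  have nz: "AE v in ?M. snd v + p \<noteq> 0" for p :: real
  proof (rule AE_restrict_errH[OF D AE_errH])
    show "AE x in density lborel std_normal_density. AE y in density lborel std_normal_density. snd (x, y) + p \<noteq> 0"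
      using quadratic_nonzero_AE[of 0 1 p] by (simp add: add.commute)
  qed measurable
  have "\<exists>A\<in>sets ?M. u = (LINT v|?M. indicator A v *\<^sub>R (1 :: real))"
  proof (rule zonoid_point_attained[where h=snd])
    show "integrable ?M (\<lambda>_. 1 :: real)"
      by (subst integrable_restrict_space) (auto intro!: H.integrable_const_bound[where B=1] split: split_indicator)
    show "integrable ?M snd"
      using snd_bound
      by (subst integrable_restrict_space)
        (auto intro!: H.integrable_const_bound[where B="\<bar>snd \<theta>\<bar>"] split: split_indicator)
    show "AE x in ?M. p \<bullet> 1 \<noteq> 0" if "p \<noteq> (0 :: real)" for p using that by simp
    show "AE x in ?M. snd x + p \<bullet> 1 \<noteq> 0" for p :: real using nz[of p] by simp
    show "p \<bullet> u \<le> (LINT x|?M. max 0 (p \<bullet> 1))" for p :: real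
    proof -
      have "p * u \<le> max 0 p * measure errH D"
        using u by (intro mult_mono) auto
      then show ?thesis
        by (simp add: measure_restrict_space space_restrict_space mult.commute)
    qed
  qed
  then obtain A where A: "A \<in> sets ?M" "u = (LINT v|?M. indicator A v *\<^sub>R (1 :: real))" by blast
  then have A': "A \<in> sets borel" "A \<subseteq> D" by (auto simp: sets_restrict_space_iff)
  have "u = measure errH A"
    unfolding A(2) using A'(2)
    by (subst integral_restrict_space) (auto simp: indicator_inter_arith[symmetric] Int_absorb1)
  then show ?thesis using A' by blast
qed

lemma assemble_in_aumann:
  assumes \<theta>: "fst \<theta> < 0" "snd \<theta> < 0" and t: "t \<in> cell_weights \<theta>"
  shows "assemble \<theta> t \<in> aumann_expectation \<theta>"
proof -
  interpret H: prob_space errH by (rule prob_space_errH)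
  define C where "C = open_cell \<theta>"
  have [measurable]: "C \<in> sets borel" by (simp add: C_def)
  let ?M = "restrict_space errH C"
  obtain c u w where t_eq: "t = (c, u, w)" by (cases t)
  have z: "c \<in> cell_zonoid \<theta>" and uw: "0 \<le> u" "0 \<le> w" "(\<Sum>y\<in>UNIV. c $ y) + u + w = measure errH C"
    using t by (auto simp: cell_weights_def t_eq C_def)
  have snd_bound: "(snd v)\<^sup>2 \<le> (snd \<theta>)\<^sup>2" if "v \<in> C" for v
    using that unfolding abs_le_square_iff[symmetric] by (auto simp: C_def open_cell_def mult_cell_def)
  have "\<exists>A\<in>sets ?M. c = (LINT v|?M. indicator A v *\<^sub>R mix_dist \<theta> v)"
  \<comment> \<open>The entries of \<open>mix_dist\<close> lie in the span of 1, x, y and xy. The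
    square of y is outside that span, so no choice of \<open>p\<close> cancels it.\<close>
  proof (rule zonoid_point_attained[where h="\<lambda>v. (snd v)\<^sup>2"])
    show "integrable ?M (mix_dist \<theta>)"
      using integrable_mix_part[OF \<theta>, of C] by (subst integrable_restrict_space) (auto simp: C_def)
    show "integrable ?M (\<lambda>v. (snd v)\<^sup>2)"
      using snd_bound
      by (subst integrable_restrict_space)
        (auto intro!: H.integrable_const_bound[where B="(snd \<theta>)\<^sup>2"] split: split_indicator)
    show "AE v in ?M. p \<bullet> mix_dist \<theta> v \<noteq> 0" if "p \<noteq> 0" for p
      using mix_dist_inner_nonzero_AE[OF \<theta>, of p 0] that by (intro AE_restrict_errH) auto
    show "AE v in ?M. (snd v)\<^sup>2 + p \<bullet> mix_dist \<theta> v \<noteq> 0" for p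
      using mix_dist_inner_nonzero_AE[OF \<theta>, of p 1] by (intro AE_restrict_errH) auto
    show "p \<bullet> c \<le> (LINT v|?M. max 0 (p \<bullet> mix_dist \<theta> v))" for p
      using z by (subst integral_restrict_space) (auto simp: cell_zonoid_def C_def)
  qed
  then obtain A where A: "A \<in> sets ?M" "c = (LINT v|?M. indicator A v *\<^sub>R mix_dist \<theta> v)" by blast
  then have A' [measurable]: "A \<in> sets borel" and AC: "A \<subseteq> C" by (auto simp: sets_restrict_space_iff)
  have iA: "integrable errH (\<lambda>v. indicator A v *\<^sub>R mix_dist \<theta> v)"
    using AC by (intro integrable_mix_part \<theta>) (auto simp: C_def)
  have c: "c = (LINT v|errH. indicator A v *\<^sub>R mix_dist \<theta> v)"
    unfolding A(2) using AC
    by (subst integral_restrict_space) (auto intro!: Bochner_Integration.integral_cong split: split_indicator)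
  have "(\<Sum>y\<in>UNIV. c $ y) = measure errH A"
    unfolding c using AC mix_dist_prob[OF \<theta>]
    by (subst sum_integral_scaleR_prob_vecs[OF iA]) (auto simp: C_def split: split_indicator_asm)
  \<comment> \<open>The coordinate sum of \<open>c\<close> is the mass of \<open>A\<close>, so the
    total mass condition leaves exactly \<open>u + w\<close> for the rest of the cell.\<close>
  then have uw': "u + w = measure errH (C - A)"
    using uw AC by (subst H.finite_measure_Diff) auto
  obtain B where B [measurable]: "B \<in> sets borel" and BC: "B \<subseteq> C - A" and u: "measure errH B = u"
    using subset_of_measure[of "C - A" \<theta> u] uw uw' by (auto simp: C_def)
  have w: "measure errH (C - A - B) = w"
    using uw' u BC by (subst H.finite_measure_Diff) auto
  \<comment> \<open>The cell is cut into \<open>A\<close>, \<open>B\<close> and the remainder, which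
    play mixed, \<open>(True, False)\<close> and \<open>(False, True)\<close>. Composing with the
    kernel makes \<open>q\<close> a selection from \<open>Q\<close> at once.\<close>
  define q where "q v = kernel \<theta> v (if v \<in> A then 3 else if v \<in> B then 1 else 2)" for v
  have q: "q v = indicator (- C) v *\<^sub>R kernel \<theta> v 1 + indicator A v *\<^sub>R mix_dist \<theta> v
      + indicator B v *\<^sub>R point_mass (True, False) + indicator (C - A - B) v *\<^sub>R point_mass (False, True)" for v
    using AC BC unfolding q_def kernel_eq[OF \<theta>] C_def[symmetric] by (auto split: split_indicator)
  have i: "integrable errH (\<lambda>v. indicator S v *\<^sub>R (e :: dist4))" if [measurable]: "S \<in> sets borel" for S e
    by (intro H.integrable_const_bound[where B="norm e"]) (auto split: split_indicator)
  have j: "integrable errH (indicator S :: _ \<Rightarrow> real)" if [measurable]: "S \<in> sets borel" for S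
    by (intro H.integrable_const_bound[where B=1]) (auto split: split_indicator)
  have "(LINT v|errH. q v) = assemble \<theta> t"
    unfolding q assemble_def t_eq prod.case outside_mean_def c u[symmetric] w[symmetric]
    using iA i[of B] i[of "C - A - B"] j[of B] j[of "C - A - B"] integrable_kernel_part[OF \<theta>, of "- C" 1]
    by (simp add: C_def[symmetric])
  moreover have "q \<in> borel_measurable borel"
  proof -
    have [measurable]: "(\<lambda>v. kernel \<theta> v 1) \<in> borel_measurable borel" by (rule kernel_measurable[OF \<theta>])
    show ?thesis unfolding q[abs_def] by measurable
  qed
  moreover have "q v \<in> Q \<theta> v" for v unfolding q_def by (rule kernel_in_Q[OF \<theta>])
  ultimately show ?thesis unfolding aumann_expectation_def by (auto intro!: exI[of _ q])
qed

section \<open>From measurable selections to laws in \<open>Gam\<close>\<close>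

lemma kernel_pair_measurable:
  assumes \<theta>: "fst \<theta> < 0" "snd \<theta> < 0"
  shows "(\<lambda>x. kernel \<theta> (fst x) (snd x)) \<in> borel_measurable (borel \<Otimes>\<^sub>M count_space selectors)"
proof -
  have [measurable]: "(\<lambda>v. point_mass (pure_profile \<theta> v)) \<in> borel_measurable borel"
    by (rule measurable_compose[OF measurable_pure_profile]) simp
  show ?thesis unfolding kernel_eq[OF \<theta>] by measurable
qed

text \<open>Push \<open>errH\<close> forward along the graph of a selector that is read off the
  selection \<open>q\<close>: the first marginal stays \<open>errH\<close>, and the kernel
  reproduces \<open>q\<close> almost everywhere.\<close>

lemma aumann_subset_L:
  assumes \<theta>: "fst \<theta> < 0" "snd \<theta> < 0"
  shows "aumann_expectation \<theta> \<subseteq> L \<theta> ` Gam"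
proof
  fix p assume "p \<in> aumann_expectation \<theta>"
  then obtain q where p: "p = (LINT v|errH. q v)" and q [measurable]: "q \<in> borel_measurable borel" and qQ: "\<And>v. q v \<in> Q \<theta> v"
    unfolding aumann_expectation_def by blast
  interpret H: prob_space errH by (rule prob_space_errH)
  have iq: "integrable errH q"
  proof (rule integral_prob_vecs)
    show "q v \<in> prob_vecs" for v using qQ Q_subset_prob by blast
  qed (simp_all add: prob_space_errH)
  \<comment> \<open>In the open cell \<open>q v\<close> is one of three known points, so the default
    3 means the mixed one. Elsewhere the label has no effect on the kernel.\<close>
  define \<sigma> where "\<sigma> v = (if q v = point_mass (True, False) then 1
    else if q v = point_mass (False, True) then 2 else 3 :: nat)" for v
  have [measurable]: "\<sigma> \<in> measurable borel (count_space selectors)"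
    unfolding \<sigma>_def by (intro measurable_If) (auto simp: selectors_def)
  have pair_meas [measurable]: "(\<lambda>v. (v, \<sigma> v)) \<in> measurable errH (borel \<Otimes>\<^sub>M count_space selectors)"
    by measurable
  define \<gamma> where "\<gamma> = distr errH (borel \<Otimes>\<^sub>M count_space selectors) (\<lambda>v. (v, \<sigma> v))"
  have "\<gamma> \<in> Gam"
  proof -
    have "prob_space \<gamma>" unfolding \<gamma>_def by (rule H.prob_space_distr) measurable
    moreover have "(LINT x|\<gamma>. indicator {..c} (fst x) - measure errH {..c}) = (0 :: real)" for c
    proof -
      have [measurable]: "{..c} \<in> sets borel" for c :: "real \<times> real" by (simp add: closed_atMost)
      have "(LINT x|\<gamma>. indicator {..c} (fst x) - measure errH {..c}) =
          (LINT v|errH. indicator {..c} v - measure errH {..c})"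
        using integral_distr[OF pair_meas, of "\<lambda>x. indicator {..c} (fst x) - measure errH {..c} :: real"]
        by (simp add: \<gamma>_def)
      also have "\<dots> = 0"
        using H.prob_space H.emeasure_finite[of "{..c}"]
        by (subst Bochner_Integration.integral_diff) (auto simp: less_top[symmetric] intro!: integrable_real_indicator)
      finally show ?thesis .
    qed
    ultimately show ?thesis unfolding Gam_def by (simp add: \<gamma>_def)
  qed
  moreover have "L \<theta> \<gamma> = p"
  proof -
    \<comment> \<open>On \<open>null_set\<close> there may be further equilibria, and
      \<open>q\<close> may differ from the tie-breaking profile; hence only an almost everywhere
      equality.\<close>
    have sel: "AE v in errH. kernel \<theta> v (\<sigma> v) = q v"
      using null_set_AE[of \<theta>]
    proof eventually_elim
      case (elim v)
      show ?case
      proof (cases "v \<in> open_cell \<theta>")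
        case True
        then show ?thesis using qQ[of v] Q_open_cell[OF \<theta> True] by (auto simp: kernel_eq[OF \<theta>] \<sigma>_def)
      next
        case False
        then have "Q \<theta> v = {kernel \<theta> v (\<sigma> v)}"
          using mixed_equilibria_singleton(1)[OF \<theta> elim False]
          by (simp add: Q_def kernel_eq[OF \<theta>] product_dist_of_bool)
        then show ?thesis using qQ[of v] by auto
      qed
    qed
    have m: "(\<lambda>v. kernel \<theta> v (\<sigma> v)) \<in> borel_measurable errH"
      using measurable_compose[OF pair_meas kernel_pair_measurable[OF \<theta>]] by simp
    have "L \<theta> \<gamma> $ y = p $ y" for y
    proof -
      have "L \<theta> \<gamma> $ y = (LINT v|errH. kernel \<theta> v (\<sigma> v) $ y)"
        unfolding L_def \<gamma>_def vec_lambda_beta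
        using integral_distr[OF pair_meas measurable_vec_nth'[OF kernel_pair_measurable[OF \<theta>]], of y]
        by (simp only: fst_conv snd_conv)
      also have "\<dots> = (LINT v|errH. q v $ y)"
      proof (rule integral_cong_AE)
        show "AE v in errH. kernel \<theta> v (\<sigma> v) $ y = q v $ y"
          using sel by eventually_elim simp
        show "(\<lambda>v. kernel \<theta> v (\<sigma> v) $ y) \<in> borel_measurable errH" by (rule measurable_vec_nth'[OF m])
        show "(\<lambda>v. q v $ y) \<in> borel_measurable errH" by measurable
      qed
      also have "\<dots> = p $ y" unfolding p by (simp add: integral_vec_nth[OF iq])
      finally show ?thesis .
    qed
    then show ?thesis by (simp add: vec_eq_iff)
  qed
  ultimately show "p \<in> L \<theta> ` Gam" by blast
qed

section \<open>From laws in \<open>Gam\<close> to cell weights\<close>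

lemma errH_eqI:
  assumes "finite_measure \<nu>" "sets \<nu> = sets borel" "\<And>c. measure \<nu> {..c} = measure errH {..c}"
  shows "\<nu> = errH"
proof (rule measure_eqI_generator_eq[where E="range atMost" and \<Omega>=UNIV and A="\<lambda>i. {..(real i, real i)}"])
  interpret H: prob_space errH by (rule prob_space_errH)
  interpret N: finite_measure \<nu> by fact
  \<comment> \<open>Quadrants are closed under intersection, the corner being the componentwise
    infimum, so they form a generator on which finite measures are determined.\<close>
  have [simp]: "{..a} \<inter> {..b} = {..inf a b}" for a b :: "real \<times> real" by auto
  show "Int_stable (range (atMost :: real \<times> real \<Rightarrow> _))" by (auto simp: Int_stable_def)
  show "emeasure \<nu> X = emeasure errH X" if "X \<in> range atMost" for X
    using that assms(3) by (auto simp: N.emeasure_eq_measure H.emeasure_eq_measure)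
  show "sets \<nu> = sigma_sets UNIV (range atMost)" "sets errH = sigma_sets UNIV (range atMost)"
    using assms(2) by (simp_all add: borel_eq_atMost[where 'a="real \<times> real"])
  show "(\<Union>i. {..(real i, real i)}) = (UNIV :: (real \<times> real) set)"
  proof safe
    fix a b :: real
    obtain n where "max a b \<le> real n" using real_arch_simple by blast
    then show "(a, b) \<in> (\<Union>i. {..(real i, real i)})" by (auto simp: less_eq_prod_def)
  qed simp
  show "emeasure \<nu> {..(real i, real i)} \<noteq> \<infinity>" for i by simp
qed auto

text \<open>The moment conditions equate the distribution function of the first marginal with that
  of \<open>errH\<close>, and a distribution function determines its law.\<close>

lemma Gam_marginal:
  assumes "\<gamma> \<in> Gam"
  shows "distr \<gamma> borel fst = errH"
proof (rule errH_eqI)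
  interpret prob_space \<gamma> using assms by (simp add: Gam_def)
  have s [measurable_cong]: "sets \<gamma> = sets (borel \<Otimes>\<^sub>M count_space selectors)"
    using assms by (simp add: Gam_def)
  show "finite_measure (distr \<gamma> borel fst)" by (rule finite_measure_distr) measurable
  fix c :: "real \<times> real"
  have [measurable]: "{..c} \<in> sets borel" for c :: "real \<times> real" by (simp add: closed_atMost)
  have "0 = (LINT x|\<gamma>. indicator {..c} (fst x) - measure errH {..c})"
    using assms unfolding Gam_def mem_Collect_eq by metis
  also have "\<dots> = (LINT x|\<gamma>. indicator {..c} (fst x)) - measure errH {..c}"
    by (subst Bochner_Integration.integral_diff)
      (auto simp: prob_space intro!: integrable_const_bound[where B=1])
  also have "(LINT x|\<gamma>. indicator {..c} (fst x)) = (LINT v|distr \<gamma> borel fst. indicator {..c} v :: real)"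
    by (rule integral_distr[of fst \<gamma> borel "indicator {..c} :: _ \<Rightarrow> real", symmetric]) measurable
  finally show "measure (distr \<gamma> borel fst) {..c} = measure errH {..c}" by simp
qed simp

text \<open>Split the kernel according to the selector in the cell. On the event that 3 is selected,
  \<open>p \<bullet> mix_dist\<close> is at most its positive part. This bound depends on the error
  alone, so the marginal condition turns it into an integral under \<open>errH\<close>, which puts
  \<open>c\<close> in \<open>cell_zonoid\<close>.\<close>

lemma L_in_assemble:
  assumes \<theta>: "fst \<theta> < 0" "snd \<theta> < 0" and \<gamma>: "\<gamma> \<in> Gam"
  shows "L \<theta> \<gamma> \<in> assemble \<theta> ` cell_weights \<theta>"
proof -
  interpret prob_space \<gamma> using \<gamma> by (simp add: Gam_def)
  have s [measurable_cong]: "sets \<gamma> = sets (borel \<Otimes>\<^sub>M count_space selectors)"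
    using \<gamma> by (simp add: Gam_def)
  have sp: "space \<gamma> = UNIV \<times> selectors"
    using sets_eq_imp_space_eq[OF s] by (simp add: space_pair_measure)
  have marg: "(LINT x|\<gamma>. f (fst x)) = (LINT v|errH. f v)" if "f \<in> borel_measurable borel"
    for f :: "real \<times> real \<Rightarrow> 'b::{banach, second_countable_topology}"
    using integral_distr[of fst \<gamma> borel f] that unfolding Gam_marginal[OF \<gamma>] by simp
  define C where "C = open_cell \<theta>"
  have [measurable]: "C \<in> sets borel" by (simp add: C_def)
  define J where "J s x = (indicator {x. fst x \<in> C \<and> snd x = s} x :: real)" for s and x :: "(real \<times> real) \<times> nat"
  have J_meas [measurable]: "J s \<in> borel_measurable \<gamma>" for s unfolding J_def by measurable
  have Ji: "integrable \<gamma> (J s)" for s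
    by (intro integrable_const_bound[where B=1]) (auto simp: J_def split: split_indicator)
  define c where "c = (LINT x|\<gamma>. J 3 x *\<^sub>R mix_dist \<theta> (fst x))"
  define u where "u = (LINT x|\<gamma>. J 1 x)"
  define w where "w = (LINT x|\<gamma>. J 2 x)"
  have mixC: "mix_dist \<theta> v \<in> prob_vecs" if "v \<in> C" for v
    using mix_dist_prob[OF \<theta>] that by (simp add: C_def)
  have ci: "integrable \<gamma> (\<lambda>x. J 3 x *\<^sub>R mix_dist \<theta> (fst x))"
    using prob_vecs_norm[OF mixC]
    by (intro integrable_const_bound[where B=1]) (auto simp: J_def split: split_indicator)
  have [measurable]: "(\<lambda>v. kernel \<theta> v 1) \<in> borel_measurable borel" by (rule kernel_measurable[OF \<theta>])
  have oi: "integrable \<gamma> (\<lambda>x. indicator (- C) (fst x) *\<^sub>R kernel \<theta> (fst x) 1)"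
    using prob_vecs_norm[OF kernel_prob[OF \<theta>]]
    by (intro integrable_const_bound[where B=1]) (auto simp del: One_nat_def split: split_indicator)
  \<comment> \<open>The last branch of the kernel takes every selector other than 1 and 2; on
    \<open>space \<gamma>\<close> only 3 is left.\<close>
  have K_eq: "kernel \<theta> (fst x) (snd x) = indicator (- C) (fst x) *\<^sub>R kernel \<theta> (fst x) 1
      + J 3 x *\<^sub>R mix_dist \<theta> (fst x) + J 1 x *\<^sub>R point_mass (True, False) + J 2 x *\<^sub>R point_mass (False, True)"
    if "x \<in> space \<gamma>" for x
    using that unfolding kernel_eq[OF \<theta>] C_def[symmetric] J_def
    by (auto simp: sp selectors_def split: split_indicator)
  have Km: "(\<lambda>x. kernel \<theta> (fst x) (snd x)) \<in> borel_measurable \<gamma>"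
    using kernel_pair_measurable[OF \<theta>] s by (simp cong: measurable_cong_sets)
  have Ki: "integrable \<gamma> (\<lambda>x. kernel \<theta> (fst x) (snd x))"
    using prob_space_axioms Km kernel_prob[OF \<theta>] by (intro integral_prob_vecs)
  have "L \<theta> \<gamma> = (LINT x|\<gamma>. kernel \<theta> (fst x) (snd x))"
    by (simp add: L_def vec_eq_iff integral_vec_nth[OF Ki])
  also have "\<dots> = (LINT x|\<gamma>. indicator (- C) (fst x) *\<^sub>R kernel \<theta> (fst x) 1
      + J 3 x *\<^sub>R mix_dist \<theta> (fst x) + J 1 x *\<^sub>R point_mass (True, False) + J 2 x *\<^sub>R point_mass (False, True))"
    by (rule Bochner_Integration.integral_cong) (simp_all add: K_eq)
  also have "\<dots> = (LINT x|\<gamma>. indicator (- C) (fst x) *\<^sub>R kernel \<theta> (fst x) 1) + c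
      + u *\<^sub>R point_mass (True, False) + w *\<^sub>R point_mass (False, True)"
    unfolding c_def u_def w_def using oi ci Ji by simp
  also have "(LINT x|\<gamma>. indicator (- C) (fst x) *\<^sub>R kernel \<theta> (fst x) 1) = outside_mean \<theta>"
    unfolding outside_mean_def C_def[symmetric]
    by (rule marg[of "\<lambda>v. indicator (- C) v *\<^sub>R kernel \<theta> v 1"]) measurable
  finally have "L \<theta> \<gamma> = assemble \<theta> (c, u, w)" by (simp add: assemble_def)
  moreover have "(c, u, w) \<in> cell_weights \<theta>"
  proof -
    have "p \<bullet> c \<le> (LINT v|errH. indicator C v * max 0 (p \<bullet> mix_dist \<theta> v))" for p
    proof -
      have "p \<bullet> c = (LINT x|\<gamma>. p \<bullet> (J 3 x *\<^sub>R mix_dist \<theta> (fst x)))"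
        unfolding c_def by (rule integral_inner_right[symmetric]) (rule ci)
      also have "\<dots> \<le> (LINT x|\<gamma>. indicator C (fst x) * max 0 (p \<bullet> mix_dist \<theta> (fst x)))"
      proof (rule integral_mono)
        have *: "\<bar>p \<bullet> mix_dist \<theta> v\<bar> \<le> norm p" if "v \<in> C" for v
        proof -
          have "\<bar>p \<bullet> mix_dist \<theta> v\<bar> \<le> norm p * norm (mix_dist \<theta> v)" by (rule Cauchy_Schwarz_ineq2)
          also have "\<dots> \<le> norm p * 1" using prob_vecs_norm[OF mixC[OF that]] by (intro mult_left_mono) auto
          finally show ?thesis by simp
        qed
        have "norm (indicator C v * max 0 (p \<bullet> mix_dist \<theta> v)) \<le> norm p" for v
          using *[of v] by (cases "v \<in> C") auto
        then show "integrable \<gamma> (\<lambda>x. indicator C (fst x) * max 0 (p \<bullet> mix_dist \<theta> (fst x)))"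
          by (intro integrable_const_bound[where B="norm p"] AE_I2) measurable
        show "p \<bullet> (J 3 x *\<^sub>R mix_dist \<theta> (fst x)) \<le> indicator C (fst x) * max 0 (p \<bullet> mix_dist \<theta> (fst x))" for x
          by (auto simp: J_def split: split_indicator)
      qed (rule integrable_inner_right[OF ci])
      also have "\<dots> = (LINT v|errH. indicator C v * max 0 (p \<bullet> mix_dist \<theta> v))"
        by (rule marg[of "\<lambda>v. indicator C v * max 0 (p \<bullet> mix_dist \<theta> v)"]) measurable
      finally show ?thesis .
    qed
    moreover have "0 \<le> u" "0 \<le> w" by (simp_all add: u_def w_def J_def)
    moreover have "(\<Sum>y\<in>UNIV. c $ y) + u + w = measure errH C"
    proof -
      have "(\<Sum>y\<in>UNIV. c $ y) = (LINT x|\<gamma>. J 3 x)"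
        unfolding c_def using mixC by (intro sum_integral_scaleR_prob_vecs[OF ci]) (auto simp: J_def split: split_indicator_asm)
      then have "(\<Sum>y\<in>UNIV. c $ y) + u + w = (LINT x|\<gamma>. J 3 x + J 1 x + J 2 x)"
        unfolding u_def w_def using Ji by simp
      also have "\<dots> = (LINT x|\<gamma>. indicator C (fst x))"
        by (rule Bochner_Integration.integral_cong) (auto simp: J_def sp selectors_def split: split_indicator)
      also have "\<dots> = (LINT v|errH. indicator C v)"
        by (rule marg) measurable
      finally show ?thesis by simp
    qed
    ultimately show ?thesis by (simp add: cell_weights_def cell_zonoid_def C_def)
  qed
  ultimately show ?thesis by blast
qed

section \<open>Total variation closedness and the conclusion\<close>

lemma closedin_tv_topology:
  assumes "closed K" "K \<subseteq> prob_vecs"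
  shows "closedin tv_topology K"
proof -
  interpret T: Metric_space prob_vecs tv_dist by (rule Metric_space_tv)
  \<comment> \<open>Singleton events bound each coordinate difference by \<open>tv_dist\<close>, and
    there are four profiles. Balls in total variation thus fit into Euclidean balls.\<close>
  have dist_le: "dist p q \<le> 4 * tv_dist p q" for p q
  proof -
    have "dist p q \<le> (\<Sum>y\<in>UNIV. \<bar>(p - q) $ y\<bar>)" unfolding dist_norm by (rule norm_le_l1_cart)
    also have "\<dots> \<le> (\<Sum>y\<in>(UNIV :: profile set). tv_dist p q)"
      using tv_dist_upper[of p "{_}" q] by (intro sum_mono) simp
    finally show ?thesis by simp
  qed
  show ?thesis unfolding tv_topology_def T.closedin_metric
  proof (intro conjI allI impI)
    show "K \<subseteq> prob_vecs" by fact
    fix p assume "p \<in> prob_vecs - K"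
    then have "open (- K)" "p \<in> - K" using assms(1) by auto
    then obtain e where e: "0 < e" "\<And>q. dist q p < e \<Longrightarrow> q \<in> - K"
      unfolding open_dist by blast
    have "disjnt K (T.mball p (e / 4))"
    proof -
      have "q \<notin> K" if "tv_dist p q < e / 4" for q
        using e(2)[of q] dist_le[of p q] that by (auto simp: dist_commute)
      then show ?thesis by (auto simp: disjnt_iff)
    qed
    then show "\<exists>r>0. disjnt K (T.mball p r)" using e(1) by (intro exI[of _ "e / 4"]) auto
  qed
qed

theorem proposition3:
  fixes \<Theta> :: "(real \<times> real) set" and \<mu> :: dist4
  assumes "\<Theta> \<subseteq> {..<0} \<times> {..<0}"
    and "\<mu> \<in> prob_vecs"
  shows "(\<forall>\<theta>\<in>\<Theta>. L \<theta> ` Gam = aumann_expectation \<theta>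
            \<and> closedin tv_topology (aumann_expectation \<theta>)
            \<and> Mbar \<theta> = aumann_expectation \<theta>)
       \<and> {\<theta>\<in>\<Theta>. \<mu> \<in> Mbar \<theta>} = {\<theta>\<in>\<Theta>. \<mu> \<in> aumann_expectation \<theta>}"
proof -
  have *: "L \<theta> ` Gam = aumann_expectation \<theta> \<and> closedin tv_topology (aumann_expectation \<theta>)
      \<and> Mbar \<theta> = aumann_expectation \<theta>" if "\<theta> \<in> \<Theta>" for \<theta>
  proof -
    have \<theta>: "fst \<theta> < 0" "snd \<theta> < 0" using assms(1) that by auto
    \<comment> \<open>The three inclusions form a cycle, so all the sets agree; closedness is
      inherited from the middle one, a continuous image of a compact set.\<close>
    have "L \<theta> ` Gam \<subseteq> assemble \<theta> ` cell_weights \<theta>" using L_in_assemble[OF \<theta>] by blast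
    moreover have "assemble \<theta> ` cell_weights \<theta> \<subseteq> aumann_expectation \<theta>"
      using assemble_in_aumann[OF \<theta>] by blast
    moreover note aumann_subset_L[OF \<theta>]
    ultimately have eq: "L \<theta> ` Gam = aumann_expectation \<theta>"
      and eq': "aumann_expectation \<theta> = assemble \<theta> ` cell_weights \<theta>" by blast+
    have cl: "closedin tv_topology (aumann_expectation \<theta>)"
      using closed_assemble[OF \<theta>] aumann_subset_prob unfolding eq'[symmetric] by (rule closedin_tv_topology)
    then have "Mbar \<theta> = aumann_expectation \<theta>" unfolding Mbar_def eq by (rule closure_of_closedin)
    with eq cl show ?thesis by blast
  qed
  then show ?thesis by auto
qed

end
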